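(* Let $n\ge 1$, let $\pi\in S_{2n}$ be a matching, and define the matching $\pi'\in S_{2n}$ by $\pi' = T^{-1}\left(T(\pi)'\right)$, where $T$ is the bijection from matchings in $S_{2n}$ to oscillating tableaux of empty shape and length $2n$ described in the context, and $T(\pi)'$ is the conjugate of the oscillating tableau $T(\pi)$. Then $$d(\pi)+d(\pi') = 2(n+1)$$ and $$maj(\pi)+maj(\pi') = 2n^2 .$$
   Context: A matching (fixed point free involution) in $S_{2n}$ is a permutation $\pi\in S_{2n}$ with $\pi^2=1$ and $\pi(i)\neq i$ for all $i=1,\dots,2n$; it is identified with the set of its blocks $\{i,\pi(i)\}$. A permutation $\pi\in S_m$ has a descent at position $i$ ($1\le i\le m-1$) if $\pi(i)>\pi(i+1)$; $Des(\pi)$ is the set of all descent positions; the descent number is $d(\pi)=|Des(\pi)|+1$; the major index is $maj(\pi)=\sum_{i\in Des(\pi)} i$. A Young diagram is a collection of boxes arranged in left-justified rows with a weakly decreasing number of boxes in each row; it corresponds to a partition $\lambda$. A Young tableau is a filling of a Young diagram with positive integers that is weakly increasing across each row and strictly increasing down each column; its shape, $\mathrm{sh}$, is the corresponding partition. The conjugate $\lambda'$ of $\lambda$ is obtained by flipping the Young diagram over its main diagonal (from upper left to lower right). An oscillating tableau of length $m$ and shape $\lambda$ is a sequence of $m+1$ partitions $(\emptyset=\lambda_0,\lambda_1,\dots,\lambda_m=\lambda)$ such that each $\lambda_i$ differs from $\lambda_{i-1}$ by a single box (i.e. is obtained by adding or removing one box; a walk on Young's lattice). The conjugate of an oscillating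 tableau $(\lambda_0,\dots,\lambda_{2n})$ is $(\lambda_0',\dots,\lambda_{2n}')$. Row-insertion of a positive integer $x$ into a tableau $P$: if $x$ is at least as large as all entries in the first row, add $x$ in a new box at the end of the first row. Otherwise, find the left-most entry in the first row strictly larger than $x$, replace it by $x$, and repeat the process with the removed ("bumped") entry on the second row, and so on, until the bumped entry can be put at the end of the row it is bumped into, or it is bumped out of the bottom, in which case it forms a new row with one entry. Sliding a hole (an empty box in a tableau): the smaller of the entry to the right of the hole and the entry below the hole is moved into the hole (if both are equal, the one below is chosen; if only one exists, that one is moved), which creates a new hole; this is repeated until the hole has no entry to its right and none below it, at which point that box is deleted from the diagram. The map $T$: given a matching $\pi\in S_{2n}$, define tableaux $P_0,P_1,\dots,P_{2n}$ by $P_0=\emptyset$ and, for $1\le i\le 2n$: (1) if $i$ is the smaller element of its block $\{i<j\}$ in $\pi$, $P_i$ is obtained from $P_{i-1}$ by row-inserting $j$; (2) if $i$ is the larger element of its block $\{i>j\}$ in $\pi$, then $P_{i-1}$ contains $i$, and $P_i$ is obtained from $P_{i-1}$ by removing $i$ and sliding the resulting hole out. Then $T(\pi)=(\mathrm{sh}(P_0),\mathrm{sh}(P_1),\dots,\mathrm{sh}(P_{2n}))$. By a known result of Sundaram, $T$ is a bijection from the set of matchings in $S_{2n}$ to the set of oscillating tableaux of empty shape and length $2n$. *)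

theory Defs
  imports Main "HOL-Combinatorics.Permutations"
begin

definition matchings :: "nat \<Rightarrow> (nat \<Rightarrow> nat) set" where
  "matchings n = {\<pi>. \<pi> permutes {1..2 * n} \<and> \<pi> \<circ> \<pi> = id \<and> (\<forall>i\<in>{1..2 * n}. \<pi> i \<noteq> i)}"

text \<open>
  In the three definitions below, a permutation \<open>\<pi>\<close> of \<open>{1..m}\<close> is read as the word
  \<open>\<pi> 1, \<dots>, \<pi> m\<close>.
\<close>

definition descents :: "nat \<Rightarrow> (nat \<Rightarrow> nat) \<Rightarrow> nat set" where
  "descents m \<pi> = {i. 1 \<le> i \<and> i < m \<and> \<pi> i > \<pi> (i + 1)}"

definition descent_number :: "nat \<Rightarrow> (nat \<Rightarrow> nat) \<Rightarrow> nat" where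
  "descent_number m \<pi> = card (descents m \<pi>) + 1"

definition major_index :: "nat \<Rightarrow> (nat \<Rightarrow> nat) \<Rightarrow> nat" where
  "major_index m \<pi> = \<Sum>(descents m \<pi>)"

text \<open>
  Partitions are represented by their Young diagrams, that is, by sets of boxes. A box is a pair
  (row, column), both counted from 0, row 0 at the top and column 0 on the left.
\<close>

type_synonym diagram = "(nat \<times> nat) set"

definition young_diagram :: "diagram \<Rightarrow> bool" where
  "young_diagram D \<longleftrightarrow>
     finite D \<and> (\<forall>r c r' c'. (r, c) \<in> D \<and> r' \<le> r \<and> c' \<le> c \<longrightarrow> (r', c') \<in> D)"

definition conjugate :: "diagram \<Rightarrow> diagram" where
  "conjugate D = prod.swap ` D"

text \<open>
  The map \<open>oscillating_of n\<close> defined at the end of this theory is a bijection from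
  \<open>matchings n\<close> to \<open>oscillating_tableaux (2 * n) {}\<close> (Sundaram).
\<close>

definition oscillating_tableaux :: "nat \<Rightarrow> diagram \<Rightarrow> diagram list set" where
  "oscillating_tableaux m D =
     {Ds. length Ds = m + 1 \<and> Ds ! 0 = {} \<and> Ds ! m = D \<and> (\<forall>E\<in>set Ds. young_diagram E) \<and>
          (\<forall>i<m. \<exists>b. b \<notin> Ds ! i \<and> Ds ! (i + 1) = insert b (Ds ! i) \<or>
                     b \<notin> Ds ! (i + 1) \<and> Ds ! i = insert b (Ds ! (i + 1)))}"

definition conjugate_oscillating :: "diagram list \<Rightarrow> diagram list" where
  "conjugate_oscillating Ds = map conjugate Ds"

text \<open>A tableau is the list of its rows, from top to bottom; no row is empty.\<close>

type_synonym tableau = "nat list list"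

definition shape :: "tableau \<Rightarrow> diagram" where
  "shape P = {(r, c). r < length P \<and> c < length (P ! r)}"

fun row_insert :: "nat \<Rightarrow> tableau \<Rightarrow> tableau" where
  "row_insert x [] = [[x]]"
| "row_insert x (R # P) =
     (case dropWhile (\<lambda>y. y \<le> x) R of
        [] \<Rightarrow> (R @ [x]) # P
      | y # S \<Rightarrow> (takeWhile (\<lambda>y. y \<le> x) R @ x # S) # row_insert y P)"

definition set_entry :: "nat \<Rightarrow> nat \<Rightarrow> nat \<Rightarrow> tableau \<Rightarrow> tableau" where
  "set_entry r c x P = P[r := (P ! r)[c := x]]"

text \<open>
  \<open>slide r c P\<close> slides out a hole at box \<open>(r, c)\<close>. The entry stored in \<open>P\<close> at the hole is
  a dummy that is never read. When the hole has stopped, it is the last box of its row,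
  and the row disappears if that was its only box.
\<close>

function slide :: "nat \<Rightarrow> nat \<Rightarrow> tableau \<Rightarrow> tableau" where
  "slide r c P =
     (let right = ((r, c + 1) \<in> shape P); below = ((r + 1, c) \<in> shape P) in
      if right \<and> (below \<longrightarrow> P ! r ! (c + 1) < P ! (r + 1) ! c)
      then slide r (c + 1) (set_entry r c (P ! r ! (c + 1)) P)
      else if below
      then slide (r + 1) c (set_entry r c (P ! (r + 1) ! c) P)
      else filter (\<lambda>R. R \<noteq> []) (P[r := butlast (P ! r)]))"
  by pat_completeness auto
termination
  by (relation "measures [\<lambda>(r, c, P). length P - r, \<lambda>(r, c, P). length (P ! r) - c]")
     (auto simp: shape_def set_entry_def)

declare slide.simps [simp del]

text \<open>Only used for an entry that occurs exactly once in the tableau.\<close>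

definition remove_entry :: "nat \<Rightarrow> tableau \<Rightarrow> tableau" where
  "remove_entry x P =
     (let (r, c) = (THE (r, c). (r, c) \<in> shape P \<and> P ! r ! c = x) in slide r c P)"

fun tableau_at :: "(nat \<Rightarrow> nat) \<Rightarrow> nat \<Rightarrow> tableau" where
  "tableau_at \<pi> 0 = []"
| "tableau_at \<pi> (Suc i) =
     (if Suc i < \<pi> (Suc i)
      then row_insert (\<pi> (Suc i)) (tableau_at \<pi> i)
      else remove_entry (Suc i) (tableau_at \<pi> i))"

definition oscillating_of :: "nat \<Rightarrow> (nat \<Rightarrow> nat) \<Rightarrow> diagram list" where
  "oscillating_of n \<pi> = map (\<lambda>i. shape (tableau_at \<pi> i)) [0..<2 * n + 1]"

end

theory Submission
  imports Defs
begin

text \<open>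
  Call \<open>i\<close> an opener if \<open>i < \<pi> i\<close> and a closer otherwise; openers are the steps at which the
  oscillating tableau grows, so conjugation preserves them. An opener followed by a closer is always a
  descent, a closer followed by an opener never is. For two consecutive openers, and likewise for two
  consecutive closers, \<open>i\<close> is a descent iff, of the two boxes involved, the outer one (the one
  contained in only one of the three diagrams) lies strictly below the other one; conjugation reverses
  this. For openers this is the row bumping lemma. For closers \<open>i, i + 1\<close>, the order in which the entries \<open>i\<close> and \<open>i + 1\<close>
  were inserted decides whether \<open>i + 1\<close> lies strictly below \<open>i\<close>, and this is unchanged until both
  entries, being the smallest ones, are slid out from the corner; two such successive sliding paths do not
  cross. Hence position \<open>i\<close> contributes \<open>1 + [i opener] - [i + 1 opener]\<close> to the two descent sets
  together, and both sums telescope. That \<open>\<pi>'\<close> has the conjugate oscillating tableau rests on the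
  surjectivity of \<open>T\<close>, obtained from reverse row insertions and reverse slides.
\<close>

section \<open>Fillings of diagrams and sliding paths\<close>

text \<open>Slides have to be compared in two ways that lists of rows hide: along their paths, and
  with their mirror images. They are therefore modelled as a relation on functions from boxes to
  numbers, where transposition is composition with \<open>prod.swap\<close>, and only the results
  are carried back to lists. Row insertion is not symmetric under transposition and stays on lists,
  by recursion on the rows. For two closers, the values of the matching are visible only in
  insertions that may lie many steps back, whereas the boxes in question are those vacated now. The
  relative row of \<open>a\<close> and \<open>Suc a\<close> carries the information across. Its two
  alternatives are written as implications that hold vacuously when one entry is absent, so they
  make sense at every stage and for every lower part of a tableau. Just before the removals these
  are the two smallest entries, and the relative row says whether \<open>Suc a\<close> is to the
  right of the corner or below it.\<close>

lemma young_diagramD: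
  "young_diagram D \<Longrightarrow> (r, c) \<in> D \<Longrightarrow> r' \<le> r \<Longrightarrow> c' \<le> c \<Longrightarrow> (r', c') \<in> D"
  unfolding young_diagram_def by blast

lemma young_diagram_mono:
  "young_diagram D \<Longrightarrow> p \<in> D \<Longrightarrow> fst q \<le> fst p \<Longrightarrow> snd q \<le> snd p \<Longrightarrow> q \<in> D"
  using young_diagramD[of D "fst p" "snd p" "fst q" "snd q"] by simp

lemma shifted_box_neq [simp]:
  "(Suc (fst h), x) \<noteq> h" "h \<noteq> (Suc (fst h), x)" "(y, Suc (snd h)) \<noteq> h" "h \<noteq> (y, Suc (snd h))"
  by (metis fst_conv snd_conv n_not_Suc_n)+

lemma swap_in_conjugate [simp]: "prod.swap b \<in> conjugate D \<longleftrightarrow> b \<in> D"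
  unfolding conjugate_def by (auto simp: prod.swap_def)

lemma in_conjugate: "b \<in> conjugate D \<longleftrightarrow> prod.swap b \<in> D"
  using swap_in_conjugate[of "prod.swap b"] by simp

lemma young_diagram_conjugate [simp]: "young_diagram (conjugate D) \<longleftrightarrow> young_diagram D"
proof -
  have *: "young_diagram (conjugate D)" if "young_diagram D" for D
    using that unfolding young_diagram_def in_conjugate by (auto simp: conjugate_def)
  have "conjugate (conjugate D) = D"
    by (auto simp: conjugate_def image_image)
  then show ?thesis using * by metis
qed

lemma conjugate_insert: "conjugate (insert b D) = insert (prod.swap b) (conjugate D)"
  by (simp add: conjugate_def)

text \<open>\<open>b'\<close> is not weakly above and to the left of \<open>b\<close>, since
  \<open>insert b A\<close> is a diagram without it. It is not strictly below and to the right
  either: the box to the right of \<open>b\<close> would then already be in \<open>A\<close> and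
  force \<open>b\<close> into \<open>A\<close>. So exactly one coordinate grows strictly, and
  transposition exchanges the alternatives.\<close>

lemma successive_boxes:
  assumes "young_diagram A" "young_diagram (insert b A)" "young_diagram (insert b' (insert b A))"
    and "b \<notin> A" "b' \<notin> insert b A"
  shows "fst b < fst b' \<longleftrightarrow> \<not> snd b < snd b'"
proof -
  obtain r c where b: "b = (r, c)" by (cases b)
  obtain r' c' where b': "b' = (r', c')" by (cases b')
  have "r < r' \<or> c < c'"
    using young_diagramD[OF assms(2), of r c r' c'] assms(5) b b' by fastforce
  moreover have False if "r < r'" "c < c'"
  proof -
    have "(r, Suc c) \<in> insert b' (insert b A)"
      using young_diagramD[OF assms(3), of r' c' r "Suc c"] b' that by simp
    then have "(r, Suc c) \<in> A" using b b' that by auto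
    then show False using young_diagramD[OF assms(1), of r "Suc c" r c] b assms(4) by simp
  qed
  ultimately show ?thesis using b b' by auto
qed

text \<open>The set need not be a diagram: a tableau with a hole \<open>h\<close> is a
  \<open>std\<close> filling of \<open>D - {h}\<close>. Comparing all pairs of boxes, not only
  neighbours, keeps the order visible across the hole.\<close>

definition std :: "diagram \<Rightarrow> (nat \<times> nat \<Rightarrow> nat) \<Rightarrow> bool" where
  "std S f \<longleftrightarrow> inj_on f S \<and>
     (\<forall>p\<in>S. \<forall>q\<in>S. fst p \<le> fst q \<and> snd p \<le> snd q \<and> p \<noteq> q \<longrightarrow> f p < f q)"

lemma std_less:
  "std S f \<Longrightarrow> (r, c) \<in> S \<Longrightarrow> (r', c') \<in> S \<Longrightarrow> r \<le> r' \<Longrightarrow> c \<le> c' \<Longrightarrow> r < r' \<or> c < c' \<Longrightarrow>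
   f (r, c) < f (r', c')"
  unfolding std_def by force

lemma std_mono:
  "std S f \<Longrightarrow> p \<in> S \<Longrightarrow> q \<in> S \<Longrightarrow> fst p \<le> fst q \<Longrightarrow> snd p \<le> snd q \<Longrightarrow> p \<noteq> q \<Longrightarrow> f p < f q"
  unfolding std_def by blast

lemma std_inj: "std S f \<Longrightarrow> p \<in> S \<Longrightarrow> q \<in> S \<Longrightarrow> f p = f q \<Longrightarrow> p = q"
  unfolding std_def by (auto dest: inj_onD)

lemma std_cong: "std S f \<Longrightarrow> (\<And>b. b \<in> S \<Longrightarrow> g b = f b) \<Longrightarrow> std S g"
  unfolding std_def by (simp cong: inj_on_cong)

section \<open>Sliding a hole through a standard filling\<close>

definition nbrs :: "nat \<times> nat \<Rightarrow> diagram" where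
  "nbrs h = {(fst h, Suc (snd h)), (Suc (fst h), snd h)}"

lemma nbrs_irrefl [simp]: "h \<notin> nbrs h"
  by (simp add: nbrs_def)

text \<open>\<open>slides D f h V e g\<close>: the hole at \<open>h\<close>, where the value of \<open>f\<close> is a dummy, slides along
  the path \<open>V\<close> to its end \<open>e\<close>, leaving the filling \<open>g\<close>.\<close>

inductive slides ::
  "diagram \<Rightarrow> (nat \<times> nat \<Rightarrow> nat) \<Rightarrow> nat \<times> nat \<Rightarrow> diagram \<Rightarrow> nat \<times> nat \<Rightarrow> (nat \<times> nat \<Rightarrow> nat) \<Rightarrow> bool"
  for D where
  stop: "nbrs h \<inter> D = {} \<Longrightarrow> slides D f h {h} h f"
| move: "h' \<in> nbrs h \<Longrightarrow> h' \<in> D \<Longrightarrow> (\<And>b. b \<in> nbrs h \<Longrightarrow> b \<in> D \<Longrightarrow> b \<noteq> h' \<Longrightarrow> f h' < f b) \<Longrightarrow>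
    slides D (f(h := f h')) h' V e g \<Longrightarrow> slides D f h (insert h V) e g"

text \<open>The moved entry must be smaller than everything below and to the right of its new box
  \<open>h\<close>. Every such box is reached through a neighbour of \<open>h\<close>, and
  \<open>h'\<close> holds the smaller neighbour. On the other side nothing changes: what lies above
  and to the left of \<open>h\<close> also lies above and to the left of \<open>h'\<close>.\<close>

lemma std_move:
  assumes D: "young_diagram D" and f: "std (D - {h}) f"
    and h': "h' \<in> nbrs h" "h' \<in> D" and min: "\<And>b. b \<in> nbrs h \<Longrightarrow> b \<in> D \<Longrightarrow> b \<noteq> h' \<Longrightarrow> f h' < f b"
  shows "std (D - {h'}) (f(h := f h'))"
proof -
  let ?g = "f(h := f h')"
  have h: "h \<in> D" "h \<noteq> h'"
    using h' young_diagram_mono[OF D, of h' h] by (auto simp: nbrs_def)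
  have "inj_on ?g (D - {h'})"
    using f h h' unfolding std_def inj_on_def
    by (metis DiffD1 DiffD2 DiffI fun_upd_other fun_upd_same singletonD singletonI)
  moreover have "?g p < ?g q" if p: "p \<in> D - {h'}" and q: "q \<in> D - {h'}"
    and pq: "fst p \<le> fst q" "snd p \<le> snd q" "p \<noteq> q" for p q
  proof -
    have mono: "f p < f q" if "p \<in> D - {h}" "q \<in> D - {h}" "fst p \<le> fst q" "snd p \<le> snd q" "p \<noteq> q" for p q
      using f that unfolding std_def by blast
    consider "p = h" | "q = h" | "p \<noteq> h" "q \<noteq> h" by blast
    then show ?thesis
    proof cases
      case 1
      \<comment> \<open>\<open>b\<close> is the first box on a path from \<open>h\<close> to
        \<open>q\<close>; it may be \<open>h'\<close> or the other neighbour.\<close>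
      define b where "b = (if fst h < fst q then (Suc (fst h), snd h) else (fst h, Suc (snd h)))"
      have b: "b \<in> nbrs h" "fst b \<le> fst q" "snd b \<le> snd q" "b \<noteq> h"
        using 1 pq by (auto simp: b_def nbrs_def prod_eq_iff)
      have bD: "b \<in> D"
        using young_diagramD[OF D, of "fst q" "snd q" "fst b" "snd b"] q b by simp
      have "f h' \<le> f b" using min b bD by (cases "b = h'") (auto simp: less_imp_le)
      moreover have "f b \<le> f q" using mono[of b q] b bD q 1 pq by (cases "b = q") (auto simp: less_imp_le)
      moreover have "f h' < f b \<or> f b < f q" using min[of b] mono[of b q] b bD q 1 pq by auto
      ultimately show ?thesis using 1 pq by auto
    next
      case 2
      then show ?thesis using mono[of p h'] pq p h h' by (auto simp: nbrs_def)
    next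
      case 3
      then show ?thesis using mono[of p q] pq p q by auto
    qed
  qed
  ultimately show ?thesis unfolding std_def by blast
qed

lemma slides_std:
  assumes "slides D f h V e g" "young_diagram D" "h \<in> D" "std (D - {h}) f"
  shows "std (D - {e}) g \<and> e \<in> D \<and> nbrs e \<inter> D = {} \<and> g ` (D - {e}) = f ` (D - {h})"
  using assms
proof (induction rule: slides.induct)
  case (stop h f)
  then show ?case by simp
next
  case (move h' h f V e g)
  have "h \<noteq> h'" using move.hyps(1) by auto
  then have "f(h := f h') ` (D - {h'}) = f ` (D - {h})"
    using move.hyps(2) move.prems(2) by (auto simp: image_iff)
  then show ?case
    using move.IH[OF move.prems(1) move.hyps(2) std_move[OF move.prems(1,3) move.hyps(1-3)]] by simp
qed

lemma slides_exists:
  assumes "finite D" "std (D - {h}) f" "young_diagram D"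
  shows "\<exists>V e g. slides D f h V e g"
proof -
  \<comment> \<open>Each move raises row plus column by one, and this sum is bounded on
    \<open>D\<close>.\<close>
  obtain N where N: "\<And>b. b \<in> D \<Longrightarrow> fst b + snd b \<le> N"
    using assms(1) finite_nat_set_iff_bounded_le[of "(\<lambda>b. fst b + snd b) ` D"] by auto
  show ?thesis using assms(2)
  proof (induction "Suc N - (fst h + snd h)" arbitrary: h f rule: less_induct)
    case less
    show ?case
    proof (cases "nbrs h \<inter> D = {}")
      case True
      then show ?thesis using slides.stop by blast
    next
      case False
      have "finite (nbrs h \<inter> D)" by (simp add: nbrs_def)
      from arg_min_if_finite[OF this False, of f] obtain h'
        where h': "h' \<in> nbrs h \<inter> D" "\<not> (\<exists>b\<in>nbrs h \<inter> D. f b < f h')" by blast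
      have lt: "f h' < f b" if "b \<in> nbrs h" "b \<in> D" "b \<noteq> h'" for b
      proof -
        have "h' \<in> D - {h}" "b \<in> D - {h}" using h' that by auto
        then have "f b \<noteq> f h'" using std_inj[OF less.prems] that by blast
        then show ?thesis using h' that by (meson IntI linorder_neqE_nat)
      qed
      have "std (D - {h'}) (f(h := f h'))"
        using std_move[OF assms(3) less.prems, of h'] h' lt by blast
      moreover have "Suc N - (fst h' + snd h') < Suc N - (fst h + snd h)"
        using N[of h'] h' by (auto simp: nbrs_def)
      ultimately obtain V e g where "slides D (f(h := f h')) h' V e g" using less.hyps by blast
      then show ?thesis using slides.move[of h' h D f] h' lt by blast
    qed
  qed
qed

lemma slides_start: "slides D f h V e g \<Longrightarrow> h \<in> V \<and> e \<in> V"
  by (induction rule: slides.induct) auto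

lemma slides_path:
  assumes "slides D f h V e g" "h \<in> D"
  shows "V \<subseteq> D" "\<And>r c. (r, c) \<in> V \<Longrightarrow> fst h \<le> r \<and> snd h \<le> c"
  using assms
  by (induction rule: slides.induct) (fastforce simp: nbrs_def)+

text \<open>Every entry moves by at most one box, so the new filling can be read off the old one.
  The end \<open>e\<close> is left out because the value there is not an entry of the
  result.\<close>

lemma slides_path_value:
  assumes "slides D f h V e g" "h \<in> D"
  shows "(b \<notin> V \<longrightarrow> g b = f b) \<and> (b \<in> V \<longrightarrow> b \<noteq> e \<longrightarrow> (\<exists>b'\<in>nbrs b \<inter> V. g b = f b'))"
  using assms
proof (induction rule: slides.induct)
  case (stop h f)
  then show ?case by simp
next
  case (move h' h f V e g)
  have V: "h' \<in> V" using slides_start[OF move.hyps(4)] by simp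
  have le: "fst h' \<le> fst b \<and> snd h' \<le> snd b" if "b \<in> V" for b
    using slides_path(2)[OF move.hyps(4,2), of "fst b" "snd b"] that by simp
  then have "h \<notin> V" using move.hyps(1) by (fastforce simp: nbrs_def)
  then have IH: "b \<notin> V \<longrightarrow> g b = (f(h := f h')) b"
      "b \<in> V \<longrightarrow> b \<noteq> e \<longrightarrow> (\<exists>b'\<in>nbrs b \<inter> V. g b = f b')"
    using move.IH[OF move.hyps(2)] by auto
  then show ?case using \<open>h \<notin> V\<close> V move.hyps(1) by auto
qed

lemma slides_path_chain:
  assumes "slides D f h V e g" "h \<in> D"
  shows "(r, c) \<in> V \<Longrightarrow> (r', c') \<in> V \<Longrightarrow> r < r' \<Longrightarrow> c \<le> c'"
  using assms
proof (induction rule: slides.induct)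
  case (stop h f)
  then show ?case by auto
next
  case (move h' h f V e g)
  have le: "fst h \<le> r \<and> snd h \<le> c" if "(r, c) \<in> V" for r c
    using slides_path(2)[OF move.hyps(4,2), of r c] that move.hyps(1) by (auto simp: nbrs_def)
  show ?case using move le by fastforce
qed

lemma slides_path_rows:
  assumes "slides D f h V e g" "h \<in> D" "fst h \<le> r" "r \<le> fst e"
  shows "\<exists>c. (r, c) \<in> V"
  using assms
proof (induction rule: slides.induct)
  case (stop h f)
  then show ?case by (cases h) auto
next
  case (move h' h f V e g)
  show ?case
  proof (cases "fst h' \<le> r")
    case True
    then show ?thesis using move by blast
  next
    case False
    then have "r = fst h" using move by (auto simp: nbrs_def)
    then show ?thesis by (metis insertI1 prod.collapse)
  qed
qed

text \<open>The second path stays strictly to the left of the first one in every row they share.\<close>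

lemma slides_noncrossing:
  assumes D: "young_diagram D" "(0, 0) \<in> D" and f: "std (D - {(0, 0)}) f"
    and V: "slides D f (0, 0) V e g" and start: "(0, 1) \<in> V"
    and W: "slides (D - {e}) k (0, 0) W e' k'" and k: "\<And>b. b \<in> D - {e} \<Longrightarrow> k b = g b"
  shows "fst e \<le> fst e'"
proof -
  note chain = slides_path_chain[OF V D(2)] and rows = slides_path_rows[OF V D(2)]
    and val = slides_path_value[OF V D(2)] and sub = slides_path(1)[OF V D(2)]
  have eV: "e \<in> V" using slides_start[OF V] by simp
  \<comment> \<open>The path only moves right and down, so below row \<open>r\<close> it stays in
    columns from \<open>c'\<close> on. A row that it meets therefore extends beyond column
    \<open>c\<close>, and the box there is off the path.\<close>
  have left: "(r', c) \<in> D - V" if "(r, c') \<in> V" "c < c'" "r < r'" "(r', c'') \<in> V" for r r' c c' c''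
  proof -
    have "c' \<le> c''" using chain that by blast
    moreover have "(r', c'') \<in> D" using sub that by auto
    ultimately have "(r', c) \<in> D" using young_diagramD[OF D(1)] that by fastforce
    moreover have "(r', c) \<notin> V" using chain[of r c' r' c] that by auto
    ultimately show ?thesis by simp
  qed
  \<comment> \<open>Generalized for the induction: the hole is anywhere strictly to the left of a
    box of the first path. Agreement of \<open>k\<close> with \<open>g\<close> is not asked for
    weakly above and to the left of the hole, where entries have been rewritten.\<close>
  have "fst e \<le> fst e'" if "slides (D - {e}) k h W e' k'"
      "\<And>b. b \<in> D - {e} \<Longrightarrow> fst h < fst b \<or> snd h < snd b \<Longrightarrow> k b = g b"
      "fst h \<le> fst e \<Longrightarrow> \<exists>c>snd h. (fst h, c) \<in> V" for k h W k'
    using that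
  proof (induction rule: slides.induct)
    case (stop h k)
    show ?case
    proof (rule ccontr)
      \<comment> \<open>The second path cannot stop above the row of \<open>e\<close>: the first one
        goes on into the next row further to the right, so the box below the hole is still
        occupied.\<close>
      assume "\<not> fst e \<le> fst h"
      then obtain c where c: "c > snd h" "(fst h, c) \<in> V" using stop by auto
      obtain c' where "(Suc (fst h), c') \<in> V" using rows[of "Suc (fst h)"] \<open>\<not> fst e \<le> fst h\<close> by auto
      then have "(Suc (fst h), snd h) \<in> D - V" using left c by blast
      then show False using stop.hyps eV by (auto simp: nbrs_def)
    qed
  next
    case (move h' h k W e' k')
    show ?case
    proof (rule move.IH)
      show "(k(h := k h')) b = g b" if "b \<in> D - {e}" "fst h' < fst b \<or> snd h' < snd b" for b
        using move.prems(1)[of b] move.hyps(1) that by (auto simp: nbrs_def)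
      show "\<exists>c>snd h'. (fst h', c) \<in> V" if row: "fst h' \<le> fst e"
      proof -
        have "fst h \<le> fst e" using row move.hyps(1) by (auto simp: nbrs_def)
        then obtain c where c: "c > snd h" "(fst h, c) \<in> V" using move.prems(2) by auto
        show ?thesis
        proof (cases "h' = (Suc (fst h), snd h)")
          case True
          then obtain c' where "(Suc (fst h), c') \<in> V" using rows[of "fst h'"] row by auto
          then show ?thesis using chain[OF c(2)] c True by (metis fst_conv lessI order_less_le_trans snd_conv)
        next
          case False
          then have h': "h' = (fst h, Suc (snd h))" using move.hyps(1) by (auto simp: nbrs_def)
          show ?thesis
          proof (cases "c = Suc (snd h)")
            case False
            then show ?thesis using c h' by (intro exI[of _ c]) auto
          next
            \<comment> \<open>The critical case: the hole moves right onto the first path. If that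
              path continues along the row, it is still ahead. If it turned down at
              \<open>h'\<close>, the entry now at \<open>h'\<close> came from the box
              \<open>b\<close> below, whose left neighbour holds a smaller entry. That neighbour is
              the box below the hole, so the hole would have moved down.\<close>
            case True
            then have "h' \<in> V" "h' \<noteq> e" using c h' move.hyps(2) by auto
            then obtain b where b: "b \<in> nbrs h'" "b \<in> V" "g h' = f b" using val by blast
            show ?thesis
            proof (cases "b = (fst h, Suc (Suc (snd h)))")
              case True
              then show ?thesis using h' b by auto
            next
              case False
              let ?d = "(Suc (fst h), snd h)"
              have b': "b = (Suc (fst h), Suc (snd h))" using False b(1) h' by (auto simp: nbrs_def)
              have d: "?d \<in> D - V" using left[OF c(2,1)] b b' by auto
              then have "f ?d < f b"
                unfolding b' using b sub b' by (intro std_less[OF f]) auto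
              moreover have "k ?d = f ?d" using d eV val move.prems(1)[of ?d] by auto
              moreover have "k h' = f b" using b(3) move.prems(1)[of h'] move.hyps(2) h' by auto
              moreover have "k h' < k ?d"
                using d eV h' by (intro move.hyps(3)) (auto simp: nbrs_def)
              ultimately show ?thesis by simp
            qed
          qed
        qed
      qed
    qed
  qed
  from this[OF W] start k show ?thesis by fastforce
qed

section \<open>Transposed slides and changes of the dummy value\<close>

lemma nbrs_swap: "nbrs (prod.swap h) = prod.swap ` nbrs h"
  by (auto simp: nbrs_def)

text \<open>Right and below enter the rules symmetrically. This turns row statements such as
  \<open>slides_noncrossing\<close> into column statements.\<close>

lemma slides_conjugate:
  assumes "slides D f h V e g"
  shows "slides (conjugate D) (f \<circ> prod.swap) (prod.swap h) (conjugate V) (prod.swap e) (g \<circ> prod.swap)"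
  using assms
proof (induction rule: slides.induct)
  case (stop h f)
  have "nbrs (prod.swap h) \<inter> conjugate D = conjugate (nbrs h \<inter> D)"
    by (simp add: nbrs_swap conjugate_def image_Int)
  moreover have "conjugate {h} = {prod.swap h}" by (simp add: conjugate_def)
  ultimately show ?case
    using stop slides.stop[of "prod.swap h" "conjugate D" "f \<circ> prod.swap"]
    by (metis conjugate_def image_empty)
next
  case (move h' h f V e g)
  have "f(h := f h') \<circ> prod.swap = (f \<circ> prod.swap)(prod.swap h := (f \<circ> prod.swap) (prod.swap h'))"
    unfolding fun_eq_iff comp_def fun_upd_def by (metis swap_swap)
  with move.IH have "slides (conjugate D) ((f \<circ> prod.swap)(prod.swap h := (f \<circ> prod.swap) (prod.swap h')))
      (prod.swap h') (conjugate V) (prod.swap e) (g \<circ> prod.swap)" by (simp only:)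
  moreover have "f h' < f (prod.swap b)"
    if "b \<in> nbrs (prod.swap h)" "b \<in> conjugate D" "b \<noteq> prod.swap h'" for b
    using that by (intro move.hyps(3)) (auto simp: nbrs_swap in_conjugate)
  ultimately show ?case unfolding conjugate_insert using move.hyps(1,2)
    by (intro slides.move[of "prod.swap h'"]) (auto simp: nbrs_swap comp_def)
qed

lemma std_conjugate: "std S f \<Longrightarrow> std (conjugate S) (f \<circ> prod.swap)"
  unfolding std_def conjugate_def by (auto simp: inj_on_def)

text \<open>The first move overwrites the dummy. It survives only if the hole does not move at all,
  and then it sits at \<open>e\<close>.\<close>

lemma slides_upd:
  assumes "slides D f h V e g"
  shows "\<exists>g'. slides D (f(h := v)) h V e g' \<and> (\<forall>b. b \<noteq> e \<longrightarrow> g' b = g b)"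
  using assms
proof cases
  case stop
  then show ?thesis using slides.stop by (metis fun_upd_other)
next
  case (move h' V')
  then have ne: "b \<noteq> h" if "b \<in> nbrs h" for b using that by auto
  have "slides D (f(h := v)) h V e g"
    unfolding move(1) using move ne by (intro slides.move[of h']) auto
  then show ?thesis by blast
qed

lemma slides_first:
  assumes "slides D f h V e g" "h' \<in> nbrs h" "h' \<in> D"
    and "\<And>b. b \<in> nbrs h \<Longrightarrow> b \<in> D \<Longrightarrow> b \<noteq> h' \<Longrightarrow> f h' < f b"
  shows "h' \<in> V"
  using assms(1)
proof cases
  case stop
  then show ?thesis using assms by blast
next
  case (move b V')
  have "b = h'" using assms(2-4) move(2-4) by (metis order_less_asym)
  then show ?thesis using move slides_start by blast
qed

text \<open>Whether \<open>a + 1\<close> lies weakly above \<open>a\<close> or strictly below it is the descent set of the filling,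
  which neither slides nor row insertions change.\<close>

definition ascent :: "diagram \<Rightarrow> (nat \<times> nat \<Rightarrow> nat) \<Rightarrow> nat \<Rightarrow> bool" where
  "ascent S f a \<longleftrightarrow> (\<forall>p\<in>S. \<forall>q\<in>S. f p = a \<and> f q = Suc a \<longrightarrow> fst q \<le> fst p)"

definition descent :: "diagram \<Rightarrow> (nat \<times> nat \<Rightarrow> nat) \<Rightarrow> nat \<Rightarrow> bool" where
  "descent S f a \<longleftrightarrow> (\<forall>p\<in>S. \<forall>q\<in>S. f p = a \<and> f q = Suc a \<longrightarrow> fst p < fst q)"

text \<open>Only an entry moving up changes its row. The danger is that \<open>a\<close> leaves the
  row of \<open>Suc a\<close> upwards. Then \<open>Suc a\<close> is to the right of
  \<open>h'\<close>, so the hole has a right neighbour, whose entry would lie strictly between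
  \<open>a\<close> and \<open>Suc a\<close>.\<close>

lemma ascent_move:
  assumes D: "young_diagram D" and f: "std (D - {h}) f"
    and h': "h' \<in> nbrs h" "h' \<in> D" and min: "\<And>b. b \<in> nbrs h \<Longrightarrow> b \<in> D \<Longrightarrow> b \<noteq> h' \<Longrightarrow> f h' < f b"
    and asc: "ascent (D - {h}) f a"
  shows "ascent (D - {h'}) (f(h := f h')) a"
  unfolding ascent_def
proof (intro ballI impI, elim conjE)
  fix p q assume p: "p \<in> D - {h'}" and q: "q \<in> D - {h'}"
    and a: "(f(h := f h')) p = a" "(f(h := f h')) q = Suc a"
  have ne: "h' \<noteq> h" using h' by auto
  consider "p = h" "q \<noteq> h" | "q = h" "p \<noteq> h" | "p \<noteq> h" "q \<noteq> h" using a by fastforce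
  then show "fst q \<le> fst p"
  proof cases
    case 1
    then have fa: "f h' = a" "f q = Suc a" using a by auto
    then have le: "fst q \<le> fst h'" using asc h' ne q 1 unfolding ascent_def by blast
    show ?thesis
    proof (rule ccontr)
      assume "\<not> ?thesis"
      then have *: "h' = (Suc (fst h), snd h)" "fst q = Suc (fst h)"
        using le h'(1) 1 by (auto simp: nbrs_def)
      have "snd h < snd q"
      proof (rule ccontr)
        assume "\<not> ?thesis"
        then have "f q \<le> f h'"
          using std_mono[OF f, of q h'] * q h' ne 1 by (cases "q = h'") auto
        then show False using fa by simp
      qed
      then have "(fst h, Suc (snd h)) \<in> D"
        using young_diagram_mono[OF D, of q] q * by auto
      moreover have "q \<noteq> (fst h, Suc (snd h))" using *(2) by auto
      ultimately have "f h' < f (fst h, Suc (snd h))" "f (fst h, Suc (snd h)) < f q"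
        using min[of "(fst h, Suc (snd h))"] * \<open>snd h < snd q\<close> q 1
          std_mono[OF f, of "(fst h, Suc (snd h))" q]
        by (auto simp: nbrs_def)
      then show False using fa by simp
    qed
  next
    case 2
    then have "f h' = Suc a" "f p = a" using a by auto
    then have "fst h' \<le> fst p" using asc h' ne p 2 unfolding ascent_def by blast
    then show ?thesis using h'(1) 2 by (auto simp: nbrs_def)
  next
    case 3
    then show ?thesis using asc a p q unfolding ascent_def by simp
  qed
qed

text \<open>The danger is that \<open>Suc a\<close> moves up into the row of \<open>a\<close>. If
  \<open>a\<close> is to the left of the hole, the box below it holds an entry strictly between
  \<open>a\<close> and \<open>Suc a\<close>. If \<open>a\<close> is to the right, the right
  neighbour of the hole holds at most \<open>a\<close>, and the slide would have taken that one
  instead.\<close>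

lemma descent_move:
  assumes D: "young_diagram D" and f: "std (D - {h}) f"
    and h': "h' \<in> nbrs h" "h' \<in> D" and min: "\<And>b. b \<in> nbrs h \<Longrightarrow> b \<in> D \<Longrightarrow> b \<noteq> h' \<Longrightarrow> f h' < f b"
    and desc: "descent (D - {h}) f a"
  shows "descent (D - {h'}) (f(h := f h')) a"
  unfolding descent_def
proof (intro ballI impI, elim conjE)
  fix p q assume p: "p \<in> D - {h'}" and q: "q \<in> D - {h'}"
    and a: "(f(h := f h')) p = a" "(f(h := f h')) q = Suc a"
  have ne: "h' \<noteq> h" using h' by auto
  consider "p = h" "q \<noteq> h" | "q = h" "p \<noteq> h" | "p \<noteq> h" "q \<noteq> h" using a by fastforce
  then show "fst p < fst q"
  proof cases
    case 1
    then have "f h' = a" "f q = Suc a" using a by auto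
    then have "fst h' < fst q" using desc h' ne q 1 unfolding descent_def by blast
    then show ?thesis using h'(1) 1 by (auto simp: nbrs_def)
  next
    case 2
    then have fa: "f h' = Suc a" "f p = a" using a by auto
    then have lt: "fst p < fst h'" using desc h' ne p 2 unfolding descent_def by blast
    show ?thesis
    proof (rule ccontr)
      assume "\<not> ?thesis"
      then have *: "h' = (Suc (fst h), snd h)" "fst p = fst h"
        using lt h'(1) 2 by (auto simp: nbrs_def)
      then have ne': "snd p \<noteq> snd h" using 2 by (auto simp: prod_eq_iff)
      show False
      proof (cases "snd p < snd h")
        case True
        let ?x = "(Suc (fst h), snd p)"
        have "?x \<in> D" using young_diagram_mono[OF D, of h'] h' * True by auto
        moreover have "p \<noteq> ?x" using *(2) by (metis fst_conv n_not_Suc_n)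
        ultimately have "f p < f ?x" "f ?x < f h'"
          using std_mono[OF f, of p ?x] std_mono[OF f, of ?x h'] p h' * True 2 by auto
        then show False using fa by simp
      next
        case False
        let ?x = "(fst h, Suc (snd h))"
        have x: "?x \<in> D" using young_diagram_mono[OF D, of p] p * False ne' by auto
        then have "f h' < f ?x" using min[of ?x] * by (auto simp: nbrs_def)
        moreover have "f ?x \<le> f p"
          using std_mono[OF f, of ?x p] x p * False ne' 2 by (cases "?x = p") auto
        ultimately show False using fa by simp
      qed
    qed
  next
    case 3
    then show ?thesis using desc a p q unfolding descent_def by simp
  qed
qed

lemma slides_ascent:
  assumes "slides D f h V e g" "young_diagram D" "h \<in> D" "std (D - {h}) f"
  shows "ascent (D - {h}) f a \<Longrightarrow> ascent (D - {e}) g a"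
    and "descent (D - {h}) f a \<Longrightarrow> descent (D - {e}) g a"
proof -
  have "(ascent (D - {h}) f a \<longrightarrow> ascent (D - {e}) g a) \<and>
      (descent (D - {h}) f a \<longrightarrow> descent (D - {e}) g a)"
    using assms
  proof (induction rule: slides.induct)
    case (stop h f)
    then show ?case by simp
  next
    case (move h' h f V e g)
    note std' = std_move[OF move.prems(1,3) move.hyps(1-3)]
    from move.IH[OF move.prems(1) move.hyps(2) std'] show ?case
      using ascent_move[OF move.prems(1,3) move.hyps(1-3)]
        descent_move[OF move.prems(1,3) move.hyps(1-3)] by blast
  qed
  then show "ascent (D - {h}) f a \<Longrightarrow> ascent (D - {e}) g a"
    and "descent (D - {h}) f a \<Longrightarrow> descent (D - {e}) g a" by auto
qed

text \<open>Reverse slides: the larger of the entries to the left of and above the hole moves into it.\<close>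

lemma slides_reverse:
  assumes D: "young_diagram D" "h \<in> D"
    and f: "std (D - {h}) f" and ex: "slides D f h V e g"
  shows "\<exists>f0 V0 g0. std (D - {(0, 0)}) f0 \<and> slides D f0 (0, 0) V0 e g0 \<and> (\<forall>b. b \<noteq> e \<longrightarrow> g0 b = g b) \<and>
    f0 ` (D - {(0, 0)}) = f ` (D - {h})"
  using D(2) f ex
proof (induction "fst h + snd h" arbitrary: h f V g rule: less_induct)
  case less
  show ?case
  proof (cases "h = (0, 0)")
    case True
    then show ?thesis using less.prems by blast
  next
    case False
    let ?N = "{b. h \<in> nbrs b}"
    have "finite ?N" by (rule finite_subset[of _ "{..fst h} \<times> {..snd h}"]) (auto simp: nbrs_def)
    moreover have "?N \<noteq> {}"
    proof (cases "fst h")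
      case 0
      then show ?thesis using False
        by (auto simp: nbrs_def prod_eq_iff intro!: exI[of _ 0] exI[of _ "snd h - 1"])
    next
      case (Suc r)
      then show ?thesis by (auto simp: nbrs_def prod_eq_iff)
    qed
    ultimately obtain b where b: "h \<in> nbrs b" "\<And>p. h \<in> nbrs p \<Longrightarrow> f p \<le> f b"
      using Max_in[of "f ` ?N"] Max_ge[of "f ` ?N"]
      by (smt (verit, ccfv_threshold) finite_imageI image_iff image_is_empty mem_Collect_eq)
    have in_D: "q \<in> D" if "fst q \<le> fst p" "snd q \<le> snd p" "p \<in> D" for p q
      using young_diagramD[OF D(1), of "fst p" "snd p" "fst q" "snd q"] that by simp
    have mono: "f p < f q" if "p \<in> D - {h}" "q \<in> D - {h}" "fst p \<le> fst q" "snd p \<le> snd q" "p \<noteq> q" for p q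
      using less.prems(2) that unfolding std_def by blast
    have bD: "b \<in> D" "b \<noteq> h"
      using in_D[of b h] b(1) less.prems by (auto simp: nbrs_def)
    let ?f = "f(h := f b)"
    have "inj_on ?f (D - {b})"
      using less.prems(2) bD unfolding std_def inj_on_def
      by (metis DiffD1 DiffD2 DiffI fun_upd_other fun_upd_same singletonD singletonI)
    moreover have "?f p < ?f q" if p: "p \<in> D - {b}" and q: "q \<in> D - {b}"
      and pq: "fst p \<le> fst q" "snd p \<le> snd q" "p \<noteq> q" for p q
    proof -
      consider "p = h" | "q = h" | "p \<noteq> h" "q \<noteq> h" by blast
      then show ?thesis
      proof cases
        case 1
        then show ?thesis using mono[of b q] pq q bD b(1) by (auto simp: nbrs_def)
      next
        case 2
        \<comment> \<open>\<open>p'\<close> is the last box before \<open>h\<close> on a path from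
          \<open>p\<close>. It competes with \<open>b\<close> for the hole, so its value is at most
          that of \<open>b\<close>.\<close>
        define p' where "p' = (if fst p < fst h then (fst h - 1, snd h) else (fst h, snd h - 1))"
        have p': "h \<in> nbrs p'" "fst p \<le> fst p'" "snd p \<le> snd p'" "p' \<noteq> h"
          using 2 pq by (auto simp: p'_def nbrs_def prod_eq_iff)
        have p'D: "p' \<in> D" using in_D[of p' h] p' less.prems(1) by (auto simp: nbrs_def)
        have "f p' \<le> f b" using b p' by blast
        moreover have "p = p' \<or> f p < f p'" using mono[of p p'] p' p'D p 2 pq by auto
        moreover have "f p \<noteq> f b" using std_inj[OF less.prems(2), of p b] p bD 2 pq by auto
        ultimately have "f p < f b" by auto
        then show ?thesis using 2 pq by auto
      next
        case 3
        then show ?thesis using mono[of p q] pq p q by auto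
      qed
    qed
    ultimately have std: "std (D - {b}) ?f" unfolding std_def by blast
    \<comment> \<open>The forward slide from \<open>b\<close> goes back to \<open>h\<close>: the
      other neighbour of \<open>b\<close> exceeds \<open>f b\<close>, which is now the value at
      \<open>h\<close>.\<close>
    have "?f h < ?f p" if "p \<in> nbrs b" "p \<in> D" "p \<noteq> h" for p
      using mono[of b p] that bD by (auto simp: nbrs_def)
    moreover have "?f(b := ?f h) = f(h := f b)" using bD by (auto simp: fun_eq_iff)
    \<comment> \<open>The given slide has an arbitrary dummy at \<open>h\<close>; it is replaced by
      the moved entry, at the cost of the value at \<open>e\<close>.\<close>
    moreover obtain g' where g': "slides D ?f h V e g'" "\<forall>b. b \<noteq> e \<longrightarrow> g' b = g b"
      using slides_upd[OF less.prems(3)] by blast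
    ultimately have sl: "slides D ?f b (insert b V) e g'"
      using slides.move[of h b D ?f V e g'] b less.prems by simp
    have im: "?f ` (D - {b}) = f ` (D - {h})" using bD less.prems(1) by (auto simp: image_iff)
    have "fst b + snd b < fst h + snd h" using b(1) by (auto simp: nbrs_def)
    from less.hyps[OF this bD(1) std sl] im g'(2) show ?thesis by simp
  qed
qed

section \<open>Row insertion into standard tableaux\<close>

definition ent :: "tableau \<Rightarrow> nat \<times> nat \<Rightarrow> nat" where
  "ent P b = P ! fst b ! snd b"

definition entries :: "tableau \<Rightarrow> nat set" where
  "entries P = ent P ` shape P"

definition standard :: "tableau \<Rightarrow> bool" where
  "standard P \<longleftrightarrow> [] \<notin> set P \<and> young_diagram (shape P) \<and> std (shape P) (ent P)"

lemma nth_list_update_less: "j < length xs \<Longrightarrow> xs[i := x] ! j = (if i = j then x else xs ! j)"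
  by (cases "i = j") auto

lemma shape_Nil [simp]: "shape [] = {}"
  by (simp add: shape_def)

lemma in_shape_Cons [simp]:
  "(0, c) \<in> shape (R # P) \<longleftrightarrow> c < length R" "(Suc r, c) \<in> shape (R # P) \<longleftrightarrow> (r, c) \<in> shape P"
  by (auto simp: shape_def)

lemma apfst_Suc_in_shape_Cons [simp]: "apfst Suc b \<in> shape (R # P) \<longleftrightarrow> b \<in> shape P"
  by (cases b) simp

lemma ent_Cons [simp]: "ent (R # P) (0, c) = R ! c" "ent (R # P) (Suc r, c) = ent P (r, c)"
  by (auto simp: ent_def)

lemma shape_Cons: "shape (R # P) = Pair 0 ` {..<length R} \<union> apfst Suc ` shape P"
proof (rule set_eqI)
  fix b show "b \<in> shape (R # P) \<longleftrightarrow> b \<in> Pair 0 ` {..<length R} \<union> apfst Suc ` shape P"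
    by (cases b; cases "fst b") (force simp: image_iff)+
qed

lemma finite_shape [simp]: "finite (shape P)"
  by (induction P) (auto simp: shape_Cons)

lemma entries_Nil [simp]: "entries [] = {}"
  by (simp add: entries_def)

lemma entries_Cons [simp]: "entries (R # P) = set R \<union> entries P"
proof -
  have "ent (R # P) ` Pair 0 ` {..<length R} = set R"
    by (auto simp: in_set_conv_nth image_iff)
  moreover have "ent (R # P) ` apfst Suc ` shape P = ent P ` shape P"
    unfolding image_image by (intro image_cong) auto
  ultimately show ?thesis by (simp add: entries_def shape_Cons image_Un)
qed

lemma in_entriesE:
  assumes "x \<in> entries P" obtains r c where "(r, c) \<in> shape P" "ent P (r, c) = x"
  using assms unfolding entries_def by auto

lemma entriesI: "(r, c) \<in> shape P \<Longrightarrow> ent P (r, c) \<in> entries P"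
  by (simp add: entries_def)

lemma standard_Nil [simp]: "standard []"
  by (simp add: standard_def young_diagram_def std_def)

text \<open>What a row on top adds to the standardness of the rows below it. Comparing with the top
  row of \<open>P\<close> suffices, as the columns of a standard \<open>P\<close> increase from
  there.\<close>

definition columns_less :: "nat list \<Rightarrow> tableau \<Rightarrow> bool" where
  "columns_less R P \<longleftrightarrow> (\<forall>c. (0, c) \<in> shape P \<longrightarrow> c < length R \<and> R ! c < ent P (0, c))"

lemma columns_less_Nil [simp]: "columns_less R []"
  by (simp add: columns_less_def)

lemma standard_ConsD:
  assumes "standard (R # P)"
  shows "R \<noteq> []" "sorted_wrt (<) R" "standard P" "columns_less R P" "set R \<inter> entries P = {}"
proof -
  have y: "young_diagram (shape (R # P))" and s: "std (shape (R # P)) (ent (R # P))"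
    and ne: "[] \<notin> set (R # P)" using assms by (auto simp: standard_def)
  show "R \<noteq> []" using ne by auto
  show "sorted_wrt (<) R" unfolding sorted_wrt_iff_nth_less
    using std_less[OF s, of 0 _ 0] by auto
  have "(r', c') \<in> shape P" if "(r, c) \<in> shape P" "r' \<le> r" "c' \<le> c" for r c r' c'
    using young_diagramD[OF y, of "Suc r" c "Suc r'" c'] that by simp
  then have "young_diagram (shape P)" by (auto simp: young_diagram_def)
  moreover have "std (shape P) (ent P)" unfolding std_def
  proof (intro conjI inj_onI ballI impI)
    fix p q assume "p \<in> shape P" "q \<in> shape P" "ent P p = ent P q"
    then show "p = q"
      using std_inj[OF s, of "(Suc (fst p), snd p)" "(Suc (fst q), snd q)"] by (auto simp: prod_eq_iff)
  next
    fix p q assume "p \<in> shape P" "q \<in> shape P" "fst p \<le> fst q \<and> snd p \<le> snd q \<and> p \<noteq> q"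
    then show "ent P p < ent P q"
      using std_mono[OF s, of "(Suc (fst p), snd p)" "(Suc (fst q), snd q)"] by (auto simp: prod_eq_iff)
  qed
  ultimately show "standard P" using ne by (auto simp: standard_def)
  show "columns_less R P" unfolding columns_less_def
  proof (intro allI impI)
    fix c assume "(0, c) \<in> shape P"
    then show "c < length R \<and> R ! c < ent P (0, c)"
      using young_diagramD[OF y, of "Suc 0" c 0 c] std_less[OF s, of 0 c "Suc 0" c] by simp
  qed
  show "set R \<inter> entries P = {}"
  proof (rule ccontr)
    assume "\<not> ?thesis"
    then obtain j r c where "j < length R" "(r, c) \<in> shape P" "R ! j = ent P (r, c)"
      by (auto simp: in_set_conv_nth elim!: in_entriesE)
    then show False using std_inj[OF s, of "(0, j)" "(Suc r, c)"] by simp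
  qed
qed

lemma standard_ConsI:
  assumes "R \<noteq> []" "sorted_wrt (<) R" "standard P" "columns_less R P" "set R \<inter> entries P = {}"
  shows "standard (R # P)"
proof -
  have y: "young_diagram (shape P)" and s: "std (shape P) (ent P)"
    and ne: "[] \<notin> set P" using assms by (auto simp: standard_def)
  have col: "c < length R \<and> R ! c < ent P (r, c)" if "(r, c) \<in> shape P" for r c
  proof -
    have "(0, c) \<in> shape P" using young_diagramD[OF y that, of 0 c] by simp
    moreover from this have "ent P (0, c) \<le> ent P (r, c)"
      using std_less[OF s, of 0 c r c] that by (cases "r = 0") auto
    ultimately show ?thesis using assms(4) by (auto simp: columns_less_def)
  qed
  have row: "R ! i < R ! j" if "i < j" "j < length R" for i j
    using assms(2) that by (simp add: sorted_wrt_iff_nth_less)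
  have "(r', c') \<in> shape (R # P)" if "(r, c) \<in> shape (R # P)" "r' \<le> r" "c' \<le> c" for r c r' c'
    using that col[of "r - 1" c] young_diagramD[OF y, of "r - 1" c "r' - 1" c']
    by (cases r; cases r') auto
  then have "young_diagram (shape (R # P))" by (auto simp: young_diagram_def)
  moreover have "std (shape (R # P)) (ent (R # P))" unfolding std_def
  proof (intro conjI inj_onI ballI impI)
    fix p q assume pq: "p \<in> shape (R # P)" "q \<in> shape (R # P)" "ent (R # P) p = ent (R # P) q"
    obtain r c r' c' where [simp]: "p = (r, c)" "q = (r', c')" by (cases p, cases q)
    have disj: "R ! i \<noteq> ent P (k, l)" if "i < length R" "(k, l) \<in> shape P" for i k l
      using assms(5) entriesI[OF that(2)] nth_mem[OF that(1)] by (metis disjoint_iff)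
    show "p = q"
    proof (cases r)
      case 0
      show ?thesis using pq 0 disj[of c "r' - 1" c'] row[of c c'] row[of c' c]
        by (cases r') (auto, metis less_irrefl linorder_neqE_nat)
    next
      case (Suc k)
      then show ?thesis using pq disj[of c' k c] std_inj[OF s, of "(k, c)" "(r' - 1, c')"]
        by (cases r') auto
    qed
  next
    fix p q assume pq: "p \<in> shape (R # P)" "q \<in> shape (R # P)" "fst p \<le> fst q \<and> snd p \<le> snd q \<and> p \<noteq> q"
    obtain r c r' c' where [simp]: "p = (r, c)" "q = (r', c')" by (cases p, cases q)
    show "ent (R # P) p < ent (R # P) q"
    proof (cases r)
      case 0
      show ?thesis
      proof (cases r')
        case 0
        then show ?thesis using pq \<open>r = 0\<close> row[of c c'] by auto
      next
        case (Suc k)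
        then have "R ! c' < ent P (k, c')" "c' < length R" using col[of k c'] pq by auto
        moreover have "R ! c \<le> R ! c'" using row[of c c'] pq \<open>c' < length R\<close> by (cases "c = c'") auto
        ultimately show ?thesis using \<open>r = 0\<close> Suc by simp
      qed
    next
      case (Suc k)
      then show ?thesis using pq std_mono[OF s, of "(k, c)" "(r' - 1, c')"] by (cases r') auto
    qed
  qed
  ultimately show ?thesis using ne assms(1) by (simp add: standard_def)
qed

section \<open>Row bumping and reverse bumping\<close>

definition pos :: "nat \<Rightarrow> nat list \<Rightarrow> nat" where
  "pos x R = length (takeWhile (\<lambda>y. y \<le> x) R)"

lemma pos_le: "pos x R \<le> length R"
  by (simp add: pos_def length_takeWhile_le)

lemma less_pos_iff: "sorted_wrt (<) R \<Longrightarrow> j < length R \<Longrightarrow> j < pos x R \<longleftrightarrow> R ! j \<le> x"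
proof (induction R arbitrary: j)
  case (Cons y R)
  show ?case
  proof (cases j)
    case 0
    then show ?thesis by (simp add: pos_def)
  next
    case (Suc i)
    have "y < R ! i" using Cons.prems Suc by simp
    then have "y \<le> x" if "R ! i \<le> x" using that by simp
    then show ?thesis using Cons.IH[of i] Cons.prems Suc by (auto simp: pos_def)
  qed
qed simp

lemma pos_eqI:
  assumes "k \<le> length R" "\<And>j. j < k \<Longrightarrow> R ! j \<le> x" "k < length R \<Longrightarrow> x < R ! k"
  shows "pos x R = k"
proof -
  have "takeWhile (\<lambda>y. y \<le> x) R = take k R"
    using assms by (intro takeWhile_eq_take_P_nth) auto
  then show ?thesis using assms(1) by (simp add: pos_def)
qed

lemma row_insert_Cons:
  "row_insert x (R # P) =
     (if pos x R < length R then R[pos x R := x] # row_insert (R ! pos x R) P else (R @ [x]) # P)"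
proof -
  have d: "dropWhile (\<lambda>y. y \<le> x) R = drop (pos x R) R"
    unfolding pos_def by (rule dropWhile_eq_drop)
  have t: "takeWhile (\<lambda>y. y \<le> x) R = take (pos x R) R"
    unfolding pos_def by (rule takeWhile_eq_take)
  show ?thesis
  proof (cases "pos x R < length R")
    case True
    then have "drop (pos x R) R = R ! pos x R # drop (Suc (pos x R)) R" by (simp add: Cons_nth_drop_Suc)
    then show ?thesis using True d t by (simp add: upd_conv_take_nth_drop)
  next
    case False
    then have "dropWhile (\<lambda>y. y \<le> x) R = []" using d by (simp del: dropWhile_eq_Nil_conv)
    then show ?thesis using False by (simp only: row_insert.simps list.case if_False)
  qed
qed

declare row_insert.simps(2) [simp del]

fun ins_box :: "nat \<Rightarrow> tableau \<Rightarrow> nat \<times> nat" where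
  "ins_box x [] = (0, 0)"
| "ins_box x (R # P) =
     (if pos x R < length R then apfst Suc (ins_box (R ! pos x R) P) else (0, length R))"

lemma row_insert_neq_Nil [simp]: "row_insert x P \<noteq> []"
  by (cases P) (auto simp: row_insert_Cons)

lemma shape_row_insert: "shape (row_insert x P) = insert (ins_box x P) (shape P)"
proof (induction P arbitrary: x)
  case Nil
  then show ?case by (auto simp: shape_Cons)
next
  case (Cons R P)
  then show ?case by (auto simp: row_insert_Cons shape_Cons)
qed

lemma ins_box_notin: "ins_box x P \<notin> shape P"
  by (induction P arbitrary: x) auto

text \<open>A bumped entry moves weakly to the left: the entry below its old box, if any, is larger,
  so it stops at column \<open>?k\<close> at the latest. Above its new box stands \<open>x\<close>
  or an entry left of column \<open>?k\<close>, both smaller than \<open>?y\<close>.\<close>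

lemma columns_less_row_insert:
  assumes R: "sorted_wrt (<) R" and k: "pos x R < length R" and "columns_less R P"
    and P: "standard P"
  shows "columns_less (R[pos x R := x]) (row_insert (R ! pos x R) P)"
proof -
  let ?k = "pos x R" let ?y = "R ! ?k"
  have xy: "x < ?y" using less_pos_iff[OF R k, of x] by simp
  have row: "R ! i < R ! j" if "i < j" "j < length R" for i j
    using R that by (simp add: sorted_wrt_iff_nth_less)
  show ?thesis
  proof (cases P)
    case Nil
    then show ?thesis using k xy row[of 0 ?k] by (cases ?k) (auto simp: columns_less_def nth_list_update)
  next
    case (Cons S P')
    have S: "sorted_wrt (<) S" using standard_ConsD P Cons by blast
    have col: "c < length R \<and> R ! c < S ! c" if "c < length S" for c
      using assms(3) that Cons by (auto simp: columns_less_def)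
    have k2: "pos ?y S \<le> ?k"
    proof (rule ccontr)
      assume gt: "\<not> ?thesis"
      then have "?k < length S" using pos_le[of ?y S] by simp
      then show False using col[of ?k] less_pos_iff[OF S, of ?k ?y] gt by auto
    qed
    have upd: "R[?k := x] ! c \<le> R ! c" if "c < length R" for c
      using xy that by (cases "c = ?k") auto
    have new: "R[?k := x] ! pos ?y S < ?y"
      using k2 xy row[of "pos ?y S" ?k] k by (cases "pos ?y S = ?k") (auto simp: nth_list_update)
    show ?thesis
    proof (cases "pos ?y S < length S")
      case True
      have "c < length R \<and> R[?k := x] ! c < S[pos ?y S := ?y] ! c" if "c < length S" for c
        using col[OF that] upd[of c] new that by (cases "c = pos ?y S") auto
      then show ?thesis using True Cons by (auto simp: columns_less_def row_insert_Cons)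
    next
      case False
      then have len: "pos ?y S = length S" using pos_le[of ?y S] by simp
      have "c < length R \<and> R[?k := x] ! c < (S @ [?y]) ! c" if "c \<le> length S" for c
        using col[of c] upd[of c] new that len k k2 by (cases "c = length S") (auto simp: nth_append)
      then show ?thesis using len Cons by (auto simp: columns_less_def row_insert_Cons)
    qed
  qed
qed

lemma standard_row_insert:
  "standard P \<Longrightarrow> x \<notin> entries P \<Longrightarrow>
   standard (row_insert x P) \<and> entries (row_insert x P) = insert x (entries P)"
proof (induction P arbitrary: x)
  case Nil
  then show ?case by (auto intro!: standard_ConsI)
next
  case (Cons R P)
  note RP = standard_ConsD[OF Cons.prems(1)]
  have x: "x \<notin> set R" "x \<notin> entries P" using Cons.prems(2) by auto
  have row: "R ! i < R ! j" if "i < j" "j < length R" for i j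
    using RP(2) that by (simp add: sorted_wrt_iff_nth_less)
  have less: "R ! j < x" if "j < pos x R" for j
    using less_pos_iff[OF RP(2), of j x] that x(1) pos_le[of x R]
    by (metis le_neq_implies_less nth_mem order_less_le_trans)
  have greater: "x < R ! j" if "\<not> j < pos x R" "j < length R" for j
    using less_pos_iff[OF RP(2), of j x] that by auto
  show ?case
  proof (cases "pos x R < length R")
    case True
    let ?k = "pos x R" let ?y = "R ! ?k"
    have y: "?y \<notin> entries P" "?y \<in> set R" using RP(5) True nth_mem by auto
    have dist: "distinct R" using RP(2) strict_sorted_iff by blast
    have set: "set (R[?k := x]) = insert x (set R - {?y})"
      using set_update_distinct[OF dist True] by auto
    note IH = Cons.IH[OF RP(3) y(1)]
    have "sorted_wrt (<) (R[?k := x])" unfolding sorted_wrt_iff_nth_less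
    proof (intro allI impI)
      fix i j assume "i < j" "j < length (R[?k := x])"
      then show "R[?k := x] ! i < R[?k := x] ! j"
        using less[of i] greater[of j] row[of i j] by (cases "i = ?k"; cases "j = ?k") auto
    qed
    moreover have "set (R[?k := x]) \<inter> entries (row_insert ?y P) = {}"
      using set IH RP(5) x Cons.prems y by auto
    ultimately have "standard (R[?k := x] # row_insert ?y P)"
      using RP IH columns_less_row_insert[OF RP(2) True RP(4,3)] by (intro standard_ConsI) auto
    moreover have "entries (R[?k := x] # row_insert ?y P) = insert x (entries (R # P))"
      using set IH y by auto
    ultimately show ?thesis using True by (simp add: row_insert_Cons)
  next
    case False
    then have len: "pos x R = length R" using pos_le[of x R] by simp
    have "sorted_wrt (<) (R @ [x])" using RP(2) less len by (auto simp: sorted_wrt_append in_set_conv_nth)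
    moreover have "columns_less (R @ [x]) P" using RP(4) by (auto simp: columns_less_def nth_append)
    ultimately have "standard ((R @ [x]) # P)" using RP x by (intro standard_ConsI) auto
    then show ?thesis using False by (simp add: row_insert_Cons)
  qed
qed

text \<open>\<open>x < y\<close> holds iff \<open>y\<close> enters the row strictly to the right of
  \<open>x\<close>, and also iff the two bumped entries are in the same order. The equivalence is
  thus handed down from row to row. It is decided when one insertion ends: after \<open>x\<close>
  has been appended, \<open>y\<close> ends in the same row iff it is larger; if \<open>y\<close> is
  appended while \<open>x\<close> bumps, \<open>y\<close> is larger.\<close>

lemma ins_box_row:
  "standard P \<Longrightarrow> x \<notin> entries P \<Longrightarrow> y \<notin> entries P \<Longrightarrow> x \<noteq> y \<Longrightarrow>
   fst (ins_box y (row_insert x P)) \<le> fst (ins_box x P) \<longleftrightarrow> x < y"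
proof (induction P arbitrary: x y)
  case Nil
  then show ?case by (auto simp: pos_def)
next
  case (Cons R P)
  note RP = standard_ConsD[OF Cons.prems(1)]
  have x: "x \<notin> set R" "x \<notin> entries P" "y \<notin> set R" "y \<notin> entries P" using Cons.prems by auto
  have row: "R ! i < R ! j" if "i < j" "j < length R" for i j
    using RP(2) that by (simp add: sorted_wrt_iff_nth_less)
  have std': "standard (row_insert x (R # P))"
    using standard_row_insert Cons.prems by blast
  show ?case
  proof (cases "pos x R < length R")
    case True
    let ?k = "pos x R" let ?R = "R[?k := x]"
    let ?x = "R ! ?k" let ?j = "pos y ?R" let ?y = "?R ! ?j"
    have R': "sorted_wrt (<) ?R"
      using standard_ConsD(2) std' True by (auto simp: row_insert_Cons)
    have x': "x < ?x" using less_pos_iff[OF RP(2) True, of x] by simp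
    have k: "?k < ?j \<longleftrightarrow> x < y"
      using less_pos_iff[OF R', of ?k y] True Cons.prems(4) by auto
    show ?thesis
    proof (cases "?j < length ?R")
      case j: True
      have eq: "?y = (if ?j = ?k then x else R ! ?j)" using j by auto
      have "?y \<in> insert x (set R)" unfolding eq using j by simp
      then have y': "?y \<notin> entries P" using RP(5) x by auto
      have "?x \<notin> entries P" using RP(5) nth_mem[OF True] by blast
      moreover have lt: "?x < ?y \<longleftrightarrow> x < y"
      proof (cases "?k < ?j")
        case True
        then show ?thesis using k eq row[of ?k ?j] j by auto
      next
        case False
        then have "?y < ?x" using eq row[of ?j ?k] True x' by auto
        then show ?thesis using k False by auto
      qed
      moreover have "?x \<noteq> ?y"
        using eq row[of ?j ?k] row[of ?k ?j] j True x'
        by (metis length_list_update less_irrefl linorder_neqE_nat)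
      ultimately have "fst (ins_box ?y (row_insert ?x P)) \<le> fst (ins_box ?x P) \<longleftrightarrow> x < y"
        using Cons.IH[OF RP(3)] y' by metis
      then show ?thesis using True j by (simp add: row_insert_Cons)
    next
      case False
      then have "?k < ?j" using True pos_le[of y ?R] by simp
      then show ?thesis using False True k by (simp add: row_insert_Cons)
    qed
  next
    case False
    then have len: "pos x R = length R" using pos_le[of x R] by simp
    have "sorted_wrt (<) (R @ [x])" using standard_ConsD(2) std' False by (auto simp: row_insert_Cons)
    from less_pos_iff[OF this, of "length R" y]
    have "length R < pos y (R @ [x]) \<longleftrightarrow> x < y" using Cons.prems(4) by auto
    then show ?thesis using False pos_le[of y "R @ [x]"] by (auto simp: row_insert_Cons)
  qed
qed

text \<open>Reverse bumping from the corner \<open>b\<close>: the entry \<open>y\<close> expelled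
  from the rows below replaces the largest smaller entry of the row above, which is expelled in
  turn.\<close>

lemma row_insert_surj:
  "standard Q \<Longrightarrow> b \<in> shape Q \<Longrightarrow> young_diagram (shape Q - {b}) \<Longrightarrow>
   \<exists>x P. standard P \<and> x \<notin> entries P \<and> row_insert x P = Q \<and> shape P = shape Q - {b}"
proof (induction Q arbitrary: b)
  case Nil
  then show ?case by simp
next
  case (Cons R Q)
  note RQ = standard_ConsD[OF Cons.prems(1)]
  obtain r c where b: "b = (r, c)" by (cases b)
  have corner: "p = b" if "p \<in> shape (R # Q)" "fst b \<le> fst p" "snd b \<le> snd p" for p
    using young_diagram_mono[OF Cons.prems(3), of p b] that by auto
  have row: "R ! i < R ! j" if "i < j" "j < length R" for i j
    using RQ(2) that by (simp add: sorted_wrt_iff_nth_less)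
  show ?case
  proof (cases r)
    case 0
    have c: "c < length R" using Cons.prems(2) b 0 by simp
    have "(0, length R - 1) = b" by (rule corner) (use c b 0 in auto)
    then have len: "length R = Suc c" using c b by auto
    then obtain R' x where R: "R = R' @ [x]" by (metis length_Suc_conv_rev)
    have lenR': "length R' = c" using len R by simp
    have col: "c' < c" if "(r', c') \<in> shape Q" for r' c'
      using corner[of "(Suc r', c')"] that b 0 by (force simp: not_less[symmetric])
    show ?thesis
    proof (cases "R' = []")
      case True
      then have "shape Q = {}" using col lenR' by auto
      then have "Q = []" using RQ(3) by (cases Q) (auto simp: standard_def shape_Cons)
      then show ?thesis using True R b 0 lenR'
        by (intro exI[of _ x] exI[of _ "[]"]) (auto simp: shape_Cons)
    next
      case False
      have s: "sorted_wrt (<) R'" "\<And>y. y \<in> set R' \<Longrightarrow> y < x" using RQ(2) R by (auto simp: sorted_wrt_append)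
      have "columns_less R' Q" using RQ(4) col lenR' R by (fastforce simp: columns_less_def nth_append)
      then have "standard (R' # Q)" using False s(1) RQ(3,5) R by (intro standard_ConsI) auto
      moreover have "x \<notin> entries (R' # Q)" using RQ(5) R s(2) by auto
      moreover have "pos x R' = length R'" using s by (intro pos_eqI) (auto intro: less_imp_le)
      then have "row_insert x (R' # Q) = R # Q" using R by (simp add: row_insert_Cons)
      moreover have "shape (R' # Q) = shape (R # Q) - {b}"
        using R b 0 lenR' by (auto simp: shape_Cons)
      ultimately show ?thesis by blast
    qed
  next
    case (Suc r')
    have b': "(r', c) \<in> shape Q" using Cons.prems(2) b Suc by simp
    have "(k', l') \<in> shape Q - {(r', c)}" if "(k, l) \<in> shape Q - {(r', c)}" "k' \<le> k" "l' \<le> l" for k l k' l'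
      using young_diagramD[OF Cons.prems(3), of "Suc k" l "Suc k'" l'] that b Suc by auto
    then have "young_diagram (shape Q - {(r', c)})"
      unfolding young_diagram_def using finite_Diff[OF finite_shape] by blast
    from Cons.IH[OF RQ(3) b' this] obtain y P where P: "standard P" "y \<notin> entries P"
      "row_insert y P = Q" "shape P = shape Q - {(r', c)}" by blast
    have eQ: "entries Q = insert y (entries P)" using standard_row_insert P by blast
    then have "y \<in> entries Q" by simp
    then obtain k l where kl: "(k, l) \<in> shape Q" "ent Q (k, l) = y" by (rule in_entriesE)
    have yR: "y \<notin> set R" using RQ(5) eQ by auto
    have "R ! 0 < y"
      using std_less[of "shape (R # Q)" "ent (R # Q)" 0 0 "Suc k" l] Cons.prems(1) kl RQ(1)
      by (auto simp: standard_def)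
    \<comment> \<open>The entry of \<open>R\<close> above \<open>y\<close> is smaller than
      \<open>y\<close>, hence so is \<open>R ! 0\<close>. This makes \<open>m\<close>, the last
      position with an entry below \<open>y\<close>, well defined.\<close>
    then have "0 < pos y R" using less_pos_iff[OF RQ(2), of 0 y] RQ(1) by simp
    then obtain m where m: "pos y R = Suc m" by (cases "pos y R") auto
    have mlen: "m < length R" using m pos_le[of y R] by simp
    have less: "R ! j < y" if "j \<le> m" for j
      using less_pos_iff[OF RQ(2), of j y] m mlen that yR nth_mem[of j R]
      by (metis le_imp_less_Suc le_neq_implies_less order_le_less_trans)
    have greater: "y < R ! j" if "m < j" "j < length R" for j
      using less_pos_iff[OF RQ(2), of j y] that m by auto
    define R0 where "R0 = R[m := y]"
    let ?x = "R ! m"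
    have R0: "sorted_wrt (<) R0" unfolding sorted_wrt_iff_nth_less R0_def
    proof (intro allI impI)
      fix i j assume "i < j" "j < length (R[m := y])"
      then show "R[m := y] ! i < R[m := y] ! j"
        using less[of i] greater[of j] row[of i j] by (cases "i = m"; cases "j = m") auto
    qed
    have dist: "distinct R" using RQ(2) strict_sorted_iff by blast
    have set: "set R0 = insert y (set R - {?x})"
      unfolding R0_def using set_update_distinct[OF dist mlen] by auto
    have pos: "pos ?x R0 = m"
      using mlen row less[of m] by (intro pos_eqI) (auto simp: R0_def intro: less_imp_le)
    have "columns_less R0 P"
    proof (cases P)
      case Nil
      then show ?thesis by simp
    next
      case (Cons S P')
      have S: "sorted_wrt (<) S" using standard_ConsD P(1) Cons by blast
      \<comment> \<open>\<open>T\<close> is the top row of \<open>Q\<close>, written as the top row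
        of \<open>P\<close> after insertion of \<open>y\<close>.\<close>
      define T where "T = (if pos y S < length S then S[pos y S := y] else S @ [y])"
      have hd: "Q = T # tl Q" using P(3) Cons by (auto simp: row_insert_Cons T_def)
      have T: "T ! pos y S = y" "pos y S < length T" "length S \<le> length T"
        using pos_le[of y S] by (auto simp: T_def nth_append)
      have TS: "T ! j = S ! j" if "j < length S" "j \<noteq> pos y S" for j
        using that by (auto simp: T_def nth_append)
      have col: "j < length R \<and> R ! j < T ! j" if "j < length T" for j
        using RQ(4) that by (subst (asm) hd) (auto simp: columns_less_def)
      \<comment> \<open>The entry of \<open>R\<close> above \<open>y\<close> is smaller than
        \<open>y\<close>, so \<open>y\<close> was bumped into a column up to \<open>m\<close>. Hence
        the entry of \<open>S\<close> in column \<open>m\<close>, if any, exceeds \<open>y\<close>,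
        and \<open>y\<close> may be put back above it.\<close>
      have "pos y S < pos y R"
        using less_pos_iff[OF RQ(2), of "pos y S" y] col[of "pos y S"] T by auto
      then have k2: "pos y S \<le> m" using m by simp
      have gt: "y < S ! j" if "j < length S" "\<not> j < pos y S" for j
        using less_pos_iff[OF S that(1), of y] that(2) by auto
      have "j < length R0 \<and> R0 ! j < S ! j" if "j < length S" for j
      proof (cases "j = m")
        case True
        then show ?thesis using gt[OF that] k2 mlen by (simp add: R0_def)
      next
        case False
        then show ?thesis using col[of j] TS[OF that] T gt[OF that] that
          by (cases "j = pos y S") (auto simp: R0_def)
      qed
      then show ?thesis using Cons by (auto simp: columns_less_def)
    qed
    then have "standard (R0 # P)"
      using R0 RQ P set eQ by (intro standard_ConsI) (auto simp: R0_def)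
    moreover have "?x \<notin> entries (R0 # P)"
      using set RQ(5) eQ nth_mem[OF mlen] less[of m] by auto
    moreover have "row_insert ?x (R0 # P) = R # Q"
      using pos mlen P(3) by (simp add: row_insert_Cons R0_def)
    moreover have "shape (R0 # P) = shape (R # Q) - {b}"
    proof (rule set_eqI)
      fix p show "p \<in> shape (R0 # P) \<longleftrightarrow> p \<in> shape (R # Q) - {b}"
        by (cases p; cases "fst p") (use P(4) b Suc in \<open>auto simp: R0_def\<close>)
    qed
    ultimately show ?thesis by blast
  qed
qed

section \<open>Relative rows of consecutive entries under row insertion\<close>

lemma ball_shape_Cons:
  "(\<forall>b\<in>shape (R # P). Q b) \<longleftrightarrow> (\<forall>c<length R. Q (0, c)) \<and> (\<forall>b\<in>shape P. Q (apfst Suc b))"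
  by (auto simp: shape_Cons)

lemma ent_Cons_apfst_Suc [simp]: "ent (R # P) (apfst Suc b) = ent P b"
  by (cases b) simp

abbreviation asc :: "tableau \<Rightarrow> nat \<Rightarrow> bool" where
  "asc P \<equiv> ascent (shape P) (ent P)"

abbreviation desc :: "tableau \<Rightarrow> nat \<Rightarrow> bool" where
  "desc P \<equiv> descent (shape P) (ent P)"

lemma asc_Cons: "asc (R # P) a \<longleftrightarrow> \<not> (a \<in> set R \<and> Suc a \<in> entries P) \<and> asc P a"
proof -
  have "x \<in> set R \<longleftrightarrow> (\<exists>c<length R. R ! c = x)" "x \<in> entries P \<longleftrightarrow> (\<exists>b\<in>shape P. ent P b = x)" for x
    by (auto simp: in_set_conv_nth entries_def)
  then show ?thesis unfolding ascent_def ball_shape_Cons by simp blast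
qed

lemma desc_Cons:
  "desc (R # P) a \<longleftrightarrow> \<not> (Suc a \<in> set R \<and> (a \<in> set R \<or> a \<in> entries P)) \<and> desc P a"
proof -
  have "x \<in> set R \<longleftrightarrow> (\<exists>c<length R. R ! c = x)" "x \<in> entries P \<longleftrightarrow> (\<exists>b\<in>shape P. ent P b = x)" for x
    by (auto simp: in_set_conv_nth entries_def)
  then show ?thesis unfolding descent_def ball_shape_Cons by simp blast
qed

lemma asc_trivial: "Suc a \<notin> entries P \<Longrightarrow> asc P a"
  by (metis ascent_def entries_def imageI)

lemma desc_trivial: "a \<notin> entries P \<or> Suc a \<notin> entries P \<Longrightarrow> desc P a"
  by (metis descent_def entries_def imageI)

text \<open>A freshly inserted entry is in the top row, and nothing lies above that.\<close>

lemma asc_row_insert_Suc: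
  assumes "standard P" "Suc a \<notin> entries P"
  shows "asc (row_insert (Suc a) P) a"
proof -
  have s: "standard (row_insert (Suc a) P)" using standard_row_insert assms by blast
  obtain R Q where RQ: "row_insert (Suc a) P = R # Q" by (metis row_insert_neq_Nil list.exhaust)
  have "Suc a \<in> set R"
    using RQ by (cases P) (auto simp: row_insert_Cons set_update_memI split: if_splits)
  then have "Suc a \<notin> entries Q" using standard_ConsD(5)[of R Q] s RQ by auto
  then show ?thesis unfolding RQ asc_Cons using asc_trivial by blast
qed

text \<open>\<open>a\<close> enters the top row and bumps the first larger entry there. If
  \<open>Suc a\<close> was in that row, it is this entry, so it ends further down.\<close>

lemma desc_row_insert_self:
  assumes "standard P" "a \<notin> entries P"
  shows "desc (row_insert a P) a"
proof (cases P)
  case Nil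
  then show ?thesis by (auto simp: descent_def shape_Cons)
next
  case (Cons R P')
  note RP = standard_ConsD[OF assms(1)[unfolded Cons]]
  have s: "standard (row_insert a P)" using standard_row_insert assms by blast
  obtain R' Q where RQ: "row_insert a P = R' # Q" by (metis row_insert_neq_Nil list.exhaust)
  have "a \<in> set R'"
    using RQ by (cases P) (auto simp: row_insert_Cons set_update_memI split: if_splits)
  then have "a \<notin> entries Q" using standard_ConsD(5)[of R' Q] s RQ by auto
  moreover have "Suc a \<notin> set R'"
  proof (cases "pos a R < length R")
    case True
    then have R': "R' = R[pos a R := a]" using RQ Cons by (simp add: row_insert_Cons)
    have "R ! j \<noteq> Suc a" if "j \<noteq> pos a R" "j < length R" for j
    proof (cases "j < pos a R")
      case True
      then show ?thesis using less_pos_iff[OF RP(2) that(2), of a] by simp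
    next
      case False
      then have "R ! pos a R < R ! j" using RP(2) that by (simp add: sorted_wrt_iff_nth_less)
      moreover have "a < R ! pos a R" using less_pos_iff[OF RP(2) True, of a] by simp
      ultimately show ?thesis by simp
    qed
    then show ?thesis unfolding R' in_set_conv_nth
      by (metis length_list_update n_not_Suc_n nth_list_update_eq nth_list_update_neq)
  next
    case False
    then have "R' = R @ [a]" using RQ Cons by (simp add: row_insert_Cons)
    moreover have "x \<le> a" if "x \<in> set R" for x
      using that less_pos_iff[OF RP(2), of _ a] False pos_le[of a R] by (auto simp: in_set_conv_nth)
    ultimately show ?thesis by fastforce
  qed
  ultimately show ?thesis unfolding RQ desc_Cons using desc_trivial by blast
qed

text \<open>Only a bumped \<open>a\<close> or \<open>Suc a\<close> needs care. If
  \<open>Suc a\<close> is bumped, then \<open>x < a\<close>, so \<open>a\<close> is not in this row,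
  as it would have been bumped first; and \<open>Suc a\<close> lands at the top of the remaining
  rows. If \<open>a\<close> is bumped, \<open>Suc a\<close> is not in the rows below.\<close>

lemma asc_row_insert:
  "standard P \<Longrightarrow> x \<notin> entries P \<Longrightarrow> x \<noteq> a \<Longrightarrow> x \<noteq> Suc a \<Longrightarrow> asc P a \<Longrightarrow> asc (row_insert x P) a"
proof (induction P arbitrary: x)
  case Nil
  then show ?case by (intro asc_trivial) simp
next
  case (Cons R P)
  note RP = standard_ConsD[OF Cons.prems(1)]
  have a: "\<not> (a \<in> set R \<and> Suc a \<in> entries P)" "asc P a" using Cons.prems(5) by (auto simp: asc_Cons)
  show ?case
  proof (cases "pos x R < length R")
    case True
    let ?k = "pos x R" let ?y = "R ! ?k"
    have y: "?y \<in> set R" "?y \<notin> entries P" using RP(5) True nth_mem by auto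
    have dist: "distinct R" using RP(2) strict_sorted_iff by blast
    have set: "set (R[?k := x]) = insert x (set R - {?y})" using set_update_distinct[OF dist True] .
    have ent: "entries (row_insert ?y P) = insert ?y (entries P)"
      using standard_row_insert RP(3) y(2) by blast
    have "x < ?y" using less_pos_iff[OF RP(2) True, of x] by simp
    consider "?y = Suc a" | "?y = a" | "?y \<noteq> a" "?y \<noteq> Suc a" by blast
    then have "\<not> (a \<in> set (R[?k := x]) \<and> Suc a \<in> entries (row_insert ?y P)) \<and> asc (row_insert ?y P) a"
    proof cases
      case 1
      have "a \<notin> set R"
      proof
        assume "a \<in> set R"
        then obtain j where j: "j < length R" "R ! j = a" by (auto simp: in_set_conv_nth)
        have "x < a" using \<open>x < ?y\<close> 1 Cons.prems(3) by simp
        then have "\<not> j < ?k" using less_pos_iff[OF RP(2) j(1), of x] j by simp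
        moreover have "j \<noteq> ?k" using j 1 by auto
        ultimately have "?y < R ! j" using RP(2) j(1) by (simp add: sorted_wrt_iff_nth_less)
        then show False using 1 j by simp
      qed
      then show ?thesis using set Cons.prems(3) asc_row_insert_Suc[OF RP(3)] y(2) 1 by auto
    next
      case 2
      then have "Suc a \<notin> entries (row_insert ?y P)" using a(1) y(1) ent by auto
      then show ?thesis using asc_trivial by blast
    next
      case 3
      then show ?thesis using Cons.IH[OF RP(3) y(2)] a set ent Cons.prems(3) by auto
    qed
    then show ?thesis using True by (simp add: row_insert_Cons asc_Cons)
  next
    case False
    then show ?thesis using a Cons.prems by (auto simp: row_insert_Cons asc_Cons)
  qed
qed

text \<open>If \<open>Suc a\<close> is bumped, the hypothesis says that \<open>a\<close> is absent
  from this row and from those below. If \<open>a\<close> is bumped, \<open>Suc a\<close> is not in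
  this row, and \<open>a\<close> lands at the top of the remaining rows with \<open>Suc a\<close>
  left below it.\<close>

lemma desc_row_insert:
  "standard P \<Longrightarrow> x \<notin> entries P \<Longrightarrow> x \<noteq> a \<Longrightarrow> x \<noteq> Suc a \<Longrightarrow> desc P a \<Longrightarrow> desc (row_insert x P) a"
proof (induction P arbitrary: x)
  case Nil
  then show ?case by (intro desc_trivial) simp
next
  case (Cons R P)
  note RP = standard_ConsD[OF Cons.prems(1)]
  have a: "\<not> (Suc a \<in> set R \<and> (a \<in> set R \<or> a \<in> entries P))" "desc P a"
    using Cons.prems(5) by (auto simp: desc_Cons)
  show ?case
  proof (cases "pos x R < length R")
    case True
    let ?k = "pos x R" let ?y = "R ! ?k"
    have y: "?y \<in> set R" "?y \<notin> entries P" using RP(5) True nth_mem by auto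
    have dist: "distinct R" using RP(2) strict_sorted_iff by blast
    have set: "set (R[?k := x]) = insert x (set R - {?y})" using set_update_distinct[OF dist True] .
    have ent: "entries (row_insert ?y P) = insert ?y (entries P)"
      using standard_row_insert RP(3) y(2) by blast
    consider "?y = Suc a" | "?y = a" | "?y \<noteq> a" "?y \<noteq> Suc a" by blast
    then have "\<not> (Suc a \<in> set (R[?k := x]) \<and> (a \<in> set (R[?k := x]) \<or> a \<in> entries (row_insert ?y P)))
        \<and> desc (row_insert ?y P) a"
    proof cases
      case 1
      then have "a \<notin> entries (row_insert ?y P)" using a(1) y(1) ent by auto
      then show ?thesis using desc_trivial set 1 Cons.prems(4) by auto
    next
      case 2
      then have "Suc a \<notin> set R" using a(1) y(1) by auto
      then show ?thesis using set Cons.prems(4) desc_row_insert_self[OF RP(3) y(2)] 2 by auto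
    next
      case 3
      then show ?thesis using Cons.IH[OF RP(3) y(2)] a set ent Cons.prems(3,4) by auto
    qed
    then show ?thesis using True by (simp add: row_insert_Cons desc_Cons)
  next
    case False
    then show ?thesis using a Cons.prems by (auto simp: row_insert_Cons desc_Cons)
  qed
qed

section \<open>Sliding in tableaux\<close>

lemma shape_set_entry [simp]: "shape (set_entry r c x P) = shape P"
  by (auto simp: shape_def set_entry_def nth_list_update_less split: if_splits)

lemma ent_set_entry:
  "(r, c) \<in> shape P \<Longrightarrow> b \<in> shape P \<Longrightarrow> ent (set_entry r c x P) b = ((ent P)((r, c) := x)) b"
  by (cases b) (auto simp: shape_def set_entry_def ent_def nth_list_update_less)

lemma Nil_set_entry [simp]:
  "[] \<notin> set P \<Longrightarrow> [] \<notin> set (set_entry r c x P)"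
  by (fastforce simp: set_entry_def in_set_conv_nth nth_list_update_less split: if_splits)

lemma delete_corner:
  assumes y: "young_diagram (shape P)" and ne: "[] \<notin> set P" and rc: "(r, c) \<in> shape P"
    and corner: "nbrs (r, c) \<inter> shape P = {}"
  defines "Q \<equiv> filter (\<lambda>R. R \<noteq> []) (P[r := butlast (P ! r)])"
  shows "[] \<notin> set Q" "shape Q = shape P - {(r, c)}" "\<And>b. b \<in> shape P - {(r, c)} \<Longrightarrow> ent Q b = ent P b"
proof -
  have r: "r < length P" and len: "length (P ! r) = Suc c"
    using rc corner by (auto simp: shape_def nbrs_def)
  show "[] \<notin> set Q" by (simp add: Q_def)
  have "shape Q = shape P - {(r, c)} \<and> (\<forall>b\<in>shape P - {(r, c)}. ent Q b = ent P b)"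
  proof (cases "c = 0")
    case True
    \<comment> \<open>A hole that stops in column 0 has no row below it, so its row is the last one
      and is the row that \<open>filter\<close> drops.\<close>
    have "length P = Suc r"
    proof (rule ccontr)
      assume "length P \<noteq> Suc r"
      then have "Suc r < length P" using r by simp
      then have "P ! Suc r \<noteq> []" using ne nth_mem by metis
      then show False using corner True \<open>Suc r < length P\<close> by (auto simp: shape_def nbrs_def)
    qed
    then obtain P' R where P: "P = P' @ [R]" "length P' = r" by (metis length_Suc_conv_rev)
    have "length R = 1" using len True P by (auto simp: nth_append)
    then have "butlast R = []" by (cases R) auto
    then have "Q = P'" using P ne unfolding Q_def by (auto simp: filter_id_conv)
    then show ?thesis using P len True
      by (auto simp: shape_def ent_def nth_append less_Suc_eq)
  next
    case False
    have "butlast (P ! r) \<noteq> []" using len False by (cases "P ! r" rule: rev_cases) auto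
    then have "R \<noteq> []" if "R \<in> set (P[r := butlast (P ! r)])" for R
      using ne that set_update_subset_insert[of P r "butlast (P ! r)"] by auto
    then have Q: "Q = P[r := butlast (P ! r)]" by (simp add: Q_def filter_id_conv)
    have "butlast (P ! r) ! j = P ! r ! j" if "j < c" for j
      by (rule nth_butlast) (use len that in simp)
    then show ?thesis using r len unfolding Q
      by (auto simp: shape_def ent_def nth_list_update_less less_Suc_eq split: if_splits)
  qed
  then show "shape Q = shape P - {(r, c)}" "\<And>b. b \<in> shape P - {(r, c)} \<Longrightarrow> ent Q b = ent P b" by auto
qed

text \<open>The bridge from the relation to the recursive function: the strict minimum demanded by
  \<open>slides\<close> decides the tests of \<open>slide\<close> at every move.\<close>

lemma slide_slides:
  assumes "slides D f h V e g" "young_diagram D" "h \<in> D" "shape P = D" "\<And>b. b \<in> D \<Longrightarrow> ent P b = f b"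
    "[] \<notin> set P"
  shows "[] \<notin> set (slide (fst h) (snd h) P) \<and> shape (slide (fst h) (snd h) P) = D - {e} \<and>
    (\<forall>b\<in>D - {e}. ent (slide (fst h) (snd h) P) b = g b)"
  using assms
proof (induction arbitrary: P rule: slides.induct)
  case (stop h f)
  have "slide (fst h) (snd h) P = filter (\<lambda>R. R \<noteq> []) (P[fst h := butlast (P ! fst h)])"
    using stop.hyps stop.prems(3) by (subst slide.simps) (auto simp: nbrs_def)
  then show ?case using delete_corner[of P "fst h" "snd h"] stop by auto
next
  case (move h' h f V e g)
  let ?P = "set_entry (fst h) (snd h) (f h') P"
  have f: "P ! r ! c = f (r, c)" if "(r, c) \<in> D" for r c
    using move.prems(4)[OF that] by (simp add: ent_def)
  have "slide (fst h) (snd h) P = slide (fst h') (snd h') ?P"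
  proof (cases "h' = (fst h, Suc (snd h))")
    case True
    have "f h' < f (Suc (fst h), snd h)" if "(Suc (fst h), snd h) \<in> D"
      using move.hyps(3)[of "(Suc (fst h), snd h)"] that True by (auto simp: nbrs_def)
    then show ?thesis
      using True move.hyps(2) move.prems(3) f by (subst slide.simps) (auto simp: Let_def)
  next
    case False
    then have h': "h' = (Suc (fst h), snd h)" using move.hyps(1) by (auto simp: nbrs_def)
    have "f h' < f (fst h, Suc (snd h))" if "(fst h, Suc (snd h)) \<in> D"
      using move.hyps(3)[of "(fst h, Suc (snd h))"] that h' by (auto simp: nbrs_def)
    then show ?thesis
      using h' move.hyps(2) move.prems(3) f by (subst slide.simps) (auto simp: Let_def)
  qed
  moreover have "ent ?P b = (f(h := f h')) b" if "b \<in> D" for b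
    using ent_set_entry[of "fst h" "snd h" P b "f h'"] move.prems that by simp
  ultimately show ?case
    using move.IH[OF move.prems(1) move.hyps(2), of ?P] move.prems by simp
qed

lemma tableau_eqI:
  assumes "[] \<notin> set P" "[] \<notin> set Q" "shape P = shape Q" "\<And>b. b \<in> shape P \<Longrightarrow> ent P b = ent Q b"
  shows "P = Q"
proof -
  have len: "r < length P \<longleftrightarrow> (r, 0) \<in> shape P" if "[] \<notin> set P" for P :: tableau and r
  proof -
    have "0 < length (P ! r)" if "r < length P" using \<open>[] \<notin> set P\<close> nth_mem[OF that] by (metis length_greater_0_conv)
    then show ?thesis by (auto simp: shape_def)
  qed
  have "r < length P \<longleftrightarrow> r < length Q" for r using len assms(1-3) by metis
  then have l: "length P = length Q" by (metis less_irrefl linorder_neqE_nat)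
  show ?thesis
  proof (rule nth_equalityI[OF l])
    fix r assume r: "r < length P"
    have "c < length (P ! r) \<longleftrightarrow> c < length (Q ! r)" for c
      using assms(3) r l by (auto simp: shape_def set_eq_iff)
    then have "length (P ! r) = length (Q ! r)" by (metis less_irrefl linorder_neqE_nat)
    then show "P ! r = Q ! r"
      using assms(4) r by (intro nth_equalityI) (auto simp: shape_def ent_def)
  qed
qed

lemma finite_initial_segment:
  fixes A :: "nat set"
  assumes "finite A" "\<And>x y. x \<in> A \<Longrightarrow> y \<le> x \<Longrightarrow> y \<in> A"
  shows "x \<in> A \<longleftrightarrow> x < card A"
proof -
  have "A = {..<card A}"
  proof (cases "A = {}")
    case False
    then have "A = {..Max A}" using assms Max_in Max_ge by (auto intro: set_eqI)
    then show ?thesis by (metis card_atMost lessThan_Suc_atMost)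
  qed simp
  then show ?thesis by blast
qed

text \<open>A reverse slide yields only a filling. The list of rows is rebuilt by counting, since
  the rows and the first column of a diagram are initial segments.\<close>

lemma tableau_of_filling:
  assumes D: "young_diagram D"
  obtains P where "[] \<notin> set P" "shape P = D" "\<And>b. b \<in> D \<Longrightarrow> ent P b = f b"
proof -
  define rows where "rows = card {r. (r, 0) \<in> D}"
  define cols where "cols r = card {c. (r, c) \<in> D}" for r
  define P where "P = map (\<lambda>r. map (\<lambda>c. f (r, c)) [0..<cols r]) [0..<rows]"
  have fin: "finite D" using D by (simp add: young_diagram_def)
  have "finite {c. (r, c) \<in> D}" for r
    by (rule finite_subset[OF _ finite_imageI[OF fin, of snd]]) force
  then have row: "(r, c) \<in> D \<longleftrightarrow> c < cols r" for r c
    using finite_initial_segment[of "{c. (r, c) \<in> D}" c] young_diagramD[OF D]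
    unfolding cols_def by blast
  have "finite {r. (r, 0) \<in> D}"
    by (rule finite_subset[OF _ finite_imageI[OF fin, of fst]]) force
  then have col: "(r, 0) \<in> D \<longleftrightarrow> r < rows" for r
    using finite_initial_segment[of "{r. (r, 0) \<in> D}" r] young_diagramD[OF D]
    unfolding rows_def by blast
  have first: "(r, 0) \<in> D" if "(r, c) \<in> D" for r c using young_diagramD[OF D that] by simp
  have "cols r \<noteq> 0" if "r < rows" for r using that row col by (metis less_nat_zero_code)
  then have "[] \<notin> set P" by (force simp: P_def)
  moreover have "(r, c) \<in> shape P \<longleftrightarrow> (r, c) \<in> D" for r c
    using first[of r c] col[of r] row[of r c] by (auto simp: P_def shape_def)
  then have "shape P = D" by auto
  moreover have "ent P b = f b" if "b \<in> D" for b
    using that first[of "fst b" "snd b"] col[of "fst b"] row[of "fst b" "snd b"]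
    by (simp add: P_def ent_def)
  ultimately show ?thesis using that by blast
qed

section \<open>Removing the smallest entry, and restoring it\<close>

lemma remove_entry_origin:
  assumes "standard P" "(0, 0) \<in> shape P" "ent P (0, 0) = a"
  shows "remove_entry a P = slide 0 0 P"
proof -
  have "(THE (r, c). (r, c) \<in> shape P \<and> P ! r ! c = a) = (0, 0)"
  proof (rule the_equality)
    show "case (0, 0) of (r, c) \<Rightarrow> (r, c) \<in> shape P \<and> P ! r ! c = a"
      using assms by (simp add: ent_def)
    show "x = (0, 0)" if "case x of (r, c) \<Rightarrow> (r, c) \<in> shape P \<and> P ! r ! c = a" for x
      using that assms std_inj[of "shape P" "ent P" x "(0, 0)"] by (auto simp: standard_def ent_def)
  qed
  then show ?thesis by (simp add: remove_entry_def)
qed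

lemma young_diagram_remove_corner:
  "young_diagram D \<Longrightarrow> nbrs e \<inter> D = {} \<Longrightarrow> young_diagram (D - {e})"
proof -
  assume D: "young_diagram D" and e: "nbrs e \<inter> D = {}"
  have "q \<noteq> e" if "p \<in> D - {e}" "fst q \<le> fst p" "snd q \<le> snd p" for p q
  proof
    assume "q = e"
    define b where "b = (if fst e < fst p then (Suc (fst e), snd e) else (fst e, Suc (snd e)))"
    have "b \<in> nbrs e" "fst b \<le> fst p" "snd b \<le> snd p"
      using that \<open>q = e\<close> by (auto simp: b_def nbrs_def prod_eq_iff)
    then show False using young_diagram_mono[OF D, of p b] that e by auto
  qed
  then have "(r', c') \<in> D - {e}" if "(r, c) \<in> D - {e}" "r' \<le> r" "c' \<le> c" for r c r' c'
    using young_diagramD[OF D, of r c r' c'] that by fastforce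
  then show ?thesis using D unfolding young_diagram_def by blast
qed

text \<open>The corner entry is below all others, so the smallest entry sits there and the hole
  starts at \<open>(0, 0)\<close>.\<close>

lemma remove_entry_Min:
  assumes P: "standard P" and a: "a \<in> entries P" "\<And>x. x \<in> entries P \<Longrightarrow> a \<le> x"
  obtains V e g where "slides (shape P) (ent P) (0, 0) V e g" "(0, 0) \<in> shape P" "ent P (0, 0) = a"
    "e \<in> shape P" "standard (remove_entry a P)" "shape (remove_entry a P) = shape P - {e}"
    "\<And>b. b \<in> shape P - {e} \<Longrightarrow> ent (remove_entry a P) b = g b"
    "entries (remove_entry a P) = entries P - {a}"
proof -
  have y: "young_diagram (shape P)" and s: "std (shape P) (ent P)" and ne: "[] \<notin> set P"
    using P by (auto simp: standard_def)
  obtain r c where rc: "(r, c) \<in> shape P" "ent P (r, c) = a" using a(1) by (rule in_entriesE)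
  have o: "(0, 0) \<in> shape P" using young_diagramD[OF y rc(1)] by simp
  have eo: "ent P (0, 0) = a"
    using std_less[OF s o rc(1)] rc(2) a(2)[OF entriesI[OF o]] by (cases "r = 0 \<and> c = 0") auto
  have s0: "std (shape P - {(0, 0)}) (ent P)" using s by (auto simp: std_def inj_on_def)
  obtain V e g where sl: "slides (shape P) (ent P) (0, 0) V e g"
    using slides_exists[OF finite_shape s0 y] by blast
  note e = slides_std[OF sl y o s0]
  let ?Q = "remove_entry a P"
  have Q: "[] \<notin> set ?Q" "shape ?Q = shape P - {e}" "\<And>b. b \<in> shape P - {e} \<Longrightarrow> ent ?Q b = g b"
    using slide_slides[OF sl y o refl refl ne] remove_entry_origin[OF P o eo] by auto
  have "young_diagram (shape ?Q)" using young_diagram_remove_corner[OF y] e Q(2) by simp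
  moreover have "std (shape ?Q) (ent ?Q)"
    unfolding Q(2) by (rule std_cong[of _ g]) (use e Q(3) in auto)
  ultimately have "standard ?Q" using Q(1) by (simp add: standard_def)
  moreover have "entries ?Q = entries P - {a}"
  proof -
    have "entries ?Q = g ` (shape P - {e})" unfolding entries_def Q(2) using Q(3) by simp
    also have "\<dots> = ent P ` (shape P - {(0, 0)})" using e by simp
    also have "\<dots> = entries P - {a}"
      using inj_on_image_set_diff[of "ent P" "shape P" "shape P" "{(0, 0)}"] s o eo
      by (simp add: entries_def std_def)
    finally show ?thesis .
  qed
  ultimately show ?thesis using that sl o eo e Q by blast
qed

lemma remove_entry_surj:
  assumes Q: "standard Q" and a: "\<And>x. x \<in> entries Q \<Longrightarrow> a < x"
    and b: "b \<notin> shape Q" and D: "young_diagram (insert b (shape Q))"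
  obtains P where "standard P" "shape P = insert b (shape Q)" "entries P = insert a (entries Q)"
    "remove_entry a P = Q"
proof -
  let ?D = "insert b (shape Q)"
  have yQ: "young_diagram (shape Q)" and sQ: "std (shape Q) (ent Q)" and neQ: "[] \<notin> set Q"
    using Q by (auto simp: standard_def)
  have Db: "?D - {b} = shape Q" using b by auto
  have "p \<notin> ?D" if "p \<in> nbrs b" for p
    using young_diagram_mono[OF yQ, of p b] that b by (auto simp: nbrs_def)
  \<comment> \<open>The new box starts as a hole that has already stopped. The reverse slide drives
    it back to the corner, where \<open>a\<close>, smaller than all entries, fits.\<close>
  then have "slides ?D (ent Q) b {b} b (ent Q)" by (intro slides.stop) blast
  moreover have "std (?D - {b}) (ent Q)" using sQ Db by simp
  ultimately obtain f V g where f: "std (?D - {(0, 0)}) f" "slides ?D f (0, 0) V b g"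
      "\<forall>p. p \<noteq> b \<longrightarrow> g p = ent Q p" "f ` (?D - {(0, 0)}) = entries Q"
    using slides_reverse[OF D, of b "ent Q" "{b}" b "ent Q"] Db unfolding entries_def by auto
  let ?f = "f((0, 0) := a)"
  obtain g' where g': "slides ?D ?f (0, 0) V b g'" "\<forall>p. p \<noteq> b \<longrightarrow> g' p = ent Q p"
    using slides_upd[OF f(2)] f(3) by metis
  obtain P where P: "[] \<notin> set P" "shape P = ?D" "\<And>p. p \<in> ?D \<Longrightarrow> ent P p = ?f p"
    using tableau_of_filling[OF D] by blast
  have o: "(0, 0) \<in> ?D" using young_diagram_mono[OF D, of b "(0, 0)"] by simp
  have gt: "a < f p" if "p \<in> ?D" "p \<noteq> (0, 0)" for p using a f(4) that by blast
  have "std ?D ?f" unfolding std_def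
  proof (intro conjI inj_onI ballI impI)
    fix p q assume "p \<in> ?D" "q \<in> ?D" "?f p = ?f q"
    then show "p = q" using gt[of p] gt[of q] std_inj[OF f(1), of p q]
      by (cases "p = (0, 0)"; cases "q = (0, 0)") auto
  next
    fix p q assume "p \<in> ?D" "q \<in> ?D" "fst p \<le> fst q \<and> snd p \<le> snd q \<and> p \<noteq> q"
    then show "?f p < ?f q" using gt[of q] std_mono[OF f(1), of p q]
      by (cases "p = (0, 0)"; cases "q = (0, 0)") (auto simp: prod_eq_iff)
  qed
  then have "std (shape P) (ent P)" unfolding P(2) by (rule std_cong) (rule P(3))
  then have sP: "standard P" using P D by (simp add: standard_def)
  have "[] \<notin> set (slide 0 0 P) \<and> shape (slide 0 0 P) = ?D - {b} \<and> (\<forall>p\<in>?D - {b}. ent (slide 0 0 P) p = g' p)"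
    using slide_slides[OF g'(1) D o P(2,3,1)] by simp
  then have "slide 0 0 P = Q"
    using neQ Db g'(2) b by (intro tableau_eqI) auto
  then have "remove_entry a P = Q" using remove_entry_origin[OF sP, of a] o P by simp
  moreover have "entries P = insert a (entries Q)"
  proof -
    have "entries P = ?f ` insert (0, 0) (?D - {(0, 0)})"
      unfolding entries_def P(2) insert_Diff[OF o] using P(3) by (rule image_cong[OF refl])
    also have "\<dots> = insert a (f ` (?D - {(0, 0)}))" by auto
    finally show ?thesis using f(4) by simp
  qed
  ultimately show ?thesis using that sP P(2) by blast
qed

section \<open>Descents of matchings\<close>

lemma matchingD:
  assumes "\<pi> \<in> matchings n" "1 \<le> j" "j \<le> 2 * n"
  shows "1 \<le> \<pi> j" "\<pi> j \<le> 2 * n" "\<pi> (\<pi> j) = j" "\<pi> j \<noteq> j"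
proof -
  have p: "\<pi> permutes {1..2 * n}" "\<pi> \<circ> \<pi> = id" "\<forall>i\<in>{1..2 * n}. \<pi> i \<noteq> i"
    using assms(1) by (auto simp: matchings_def)
  have "\<pi> j \<in> {1..2 * n}" using permutes_in_image[OF p(1), of j] assms(2,3) by simp
  then show "1 \<le> \<pi> j" "\<pi> j \<le> 2 * n" by auto
  show "\<pi> (\<pi> j) = j" using p(2) by (metis comp_apply id_apply)
  show "\<pi> j \<noteq> j" using p(3) assms(2,3) by simp
qed

text \<open>The entries are the larger ends of the blocks that are open after step \<open>k\<close>.
  All exceed \<open>k\<close>, so at a closer the entry removed is the smallest one.\<close>

lemma tableau_at_entries:
  assumes \<pi>: "\<pi> \<in> matchings n"
  shows "k \<le> 2 * n \<Longrightarrow>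
    standard (tableau_at \<pi> k) \<and> entries (tableau_at \<pi> k) = {j. k < j \<and> j \<le> 2 * n \<and> \<pi> j \<le> k}"
proof (induction k)
  case 0
  have "\<not> \<pi> j \<le> 0" if "0 < j" "j \<le> 2 * n" for j using matchingD(1)[OF \<pi>, of j] that by auto
  then have "{j. 0 < j \<and> j \<le> 2 * n \<and> \<pi> j \<le> 0} = {}" by blast
  then show ?case by simp
next
  case (Suc k)
  let ?x = "\<pi> (Suc k)"
  have IH: "standard (tableau_at \<pi> k)" "entries (tableau_at \<pi> k) = {j. k < j \<and> j \<le> 2 * n \<and> \<pi> j \<le> k}"
    using Suc by auto
  note x = matchingD[OF \<pi>, of "Suc k"]
  have inv: "\<pi> j = Suc k \<longleftrightarrow> j = ?x" if "1 \<le> j" "j \<le> 2 * n" for j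
    using matchingD[OF \<pi> that] x Suc.prems by auto
  show ?case
  proof (cases "Suc k < ?x")
    case True
    have "?x \<notin> entries (tableau_at \<pi> k)" using IH(2) x(3) Suc.prems by simp
    moreover have "{j. Suc k < j \<and> j \<le> 2 * n \<and> \<pi> j \<le> Suc k} = insert ?x {j. k < j \<and> j \<le> 2 * n \<and> \<pi> j \<le> k}"
    proof (rule set_eqI)
      fix j
      show "j \<in> {j. Suc k < j \<and> j \<le> 2 * n \<and> \<pi> j \<le> Suc k} \<longleftrightarrow>
          j \<in> insert ?x {j. k < j \<and> j \<le> 2 * n \<and> \<pi> j \<le> k}"
      proof (cases "1 \<le> j \<and> j \<le> 2 * n")
        case True
        then show ?thesis
          using inv[of j] \<open>Suc k < ?x\<close> x Suc.prems by (cases "j = Suc k") (auto simp: le_Suc_eq)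
      next
        case False
        then show ?thesis using \<open>Suc k < ?x\<close> x Suc.prems by auto
      qed
    qed
    ultimately show ?thesis using standard_row_insert[OF IH(1)] True IH(2) by simp
  next
    case False
    then have lt: "?x \<le> k" using x(4) Suc.prems by simp
    have "Suc k \<in> entries (tableau_at \<pi> k)" using IH(2) lt Suc.prems by simp
    moreover have "Suc k \<le> y" if "y \<in> entries (tableau_at \<pi> k)" for y using that IH(2) by auto
    ultimately have *: "standard (remove_entry (Suc k) (tableau_at \<pi> k))"
      "entries (remove_entry (Suc k) (tableau_at \<pi> k)) = entries (tableau_at \<pi> k) - {Suc k}"
      by (metis remove_entry_Min[OF IH(1)])+
    have "{j. Suc k < j \<and> j \<le> 2 * n \<and> \<pi> j \<le> Suc k} = {j. k < j \<and> j \<le> 2 * n \<and> \<pi> j \<le> k} - {Suc k}"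
    proof -
      have "\<pi> j \<noteq> Suc k" if "Suc k < j" "j \<le> 2 * n" for j
        using inv[of j] that lt by auto
      then show ?thesis by (force simp: le_Suc_eq)
    qed
    then show ?thesis using * IH(2) False by simp
  qed
qed

lemma tableau_at_open:
  assumes \<pi>: "\<pi> \<in> matchings n" and k: "k < 2 * n" "Suc k < \<pi> (Suc k)"
  shows "tableau_at \<pi> (Suc k) = row_insert (\<pi> (Suc k)) (tableau_at \<pi> k)"
    and "\<pi> (Suc k) \<notin> entries (tableau_at \<pi> k)"
  using tableau_at_entries[OF \<pi>, of k] matchingD(3)[OF \<pi>, of "Suc k"] k by auto

lemma tableau_at_close:
  assumes \<pi>: "\<pi> \<in> matchings n" and k: "k < 2 * n" "\<not> Suc k < \<pi> (Suc k)"
  obtains V e g where "slides (shape (tableau_at \<pi> k)) (ent (tableau_at \<pi> k)) (0, 0) V e g"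
    "(0, 0) \<in> shape (tableau_at \<pi> k)" "ent (tableau_at \<pi> k) (0, 0) = Suc k"
    "e \<in> shape (tableau_at \<pi> k)" "shape (tableau_at \<pi> (Suc k)) = shape (tableau_at \<pi> k) - {e}"
    "\<And>b. b \<in> shape (tableau_at \<pi> k) - {e} \<Longrightarrow> ent (tableau_at \<pi> (Suc k)) b = g b"
proof -
  note T = tableau_at_entries[OF \<pi>, of k]
  have "\<pi> (Suc k) \<le> k" using matchingD(4)[OF \<pi>, of "Suc k"] k by simp
  then have a: "Suc k \<in> entries (tableau_at \<pi> k)" using T k by simp
  have P: "standard (tableau_at \<pi> k)" using T k by simp
  have min: "Suc k \<le> y" if "y \<in> entries (tableau_at \<pi> k)" for y using that T k by auto
  show thesis
  proof (rule remove_entry_Min[OF P a min])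
    fix V e g
    assume "slides (shape (tableau_at \<pi> k)) (ent (tableau_at \<pi> k)) (0, 0) V e g"
      "(0, 0) \<in> shape (tableau_at \<pi> k)" "ent (tableau_at \<pi> k) (0, 0) = Suc k" "e \<in> shape (tableau_at \<pi> k)"
      "shape (remove_entry (Suc k) (tableau_at \<pi> k)) = shape (tableau_at \<pi> k) - {e}"
      "\<And>b. b \<in> shape (tableau_at \<pi> k) - {e} \<Longrightarrow> ent (remove_entry (Suc k) (tableau_at \<pi> k)) b = g b"
    then show thesis using that[of V e g] k(2) by simp
  qed
qed

section \<open>Two consecutive openers, two consecutive closers\<close>

lemma descent_open:
  assumes \<pi>: "\<pi> \<in> matchings n" and k: "Suc k < 2 * n"
    and op: "Suc k < \<pi> (Suc k)" "Suc (Suc k) < \<pi> (Suc (Suc k))"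
    and b: "b \<notin> shape (tableau_at \<pi> k)" "shape (tableau_at \<pi> (Suc k)) = insert b (shape (tableau_at \<pi> k))"
    and b': "b' \<notin> shape (tableau_at \<pi> (Suc k))"
      "shape (tableau_at \<pi> (Suc (Suc k))) = insert b' (shape (tableau_at \<pi> (Suc k)))"
  shows "\<pi> (Suc k) > \<pi> (Suc (Suc k)) \<longleftrightarrow> fst b < fst b'"
proof -
  let ?P = "tableau_at \<pi> k" let ?x = "\<pi> (Suc k)" let ?y = "\<pi> (Suc (Suc k))"
  note x = tableau_at_open[OF \<pi> _ op(1)] and y = tableau_at_open[OF \<pi> k op(2)]
  have P: "standard ?P" "standard (row_insert ?x ?P)" using tableau_at_entries[OF \<pi>] x(1) k
    by (metis Suc_lessD less_imp_le)+
  have e: "entries (row_insert ?x ?P) = insert ?x (entries ?P)"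
    using standard_row_insert[OF P(1)] x(2) k by simp
  have xy: "?x \<notin> entries ?P" "?y \<notin> entries ?P" "?x \<noteq> ?y" using x y k e by auto
  have "b = ins_box ?x ?P"
    using b x(1) k shape_row_insert[of ?x ?P] by auto
  moreover have "b' = ins_box ?y (row_insert ?x ?P)"
    using b' x(1) y(1) k shape_row_insert[of ?y "row_insert ?x ?P"] by auto
  ultimately show ?thesis using ins_box_row[OF P(1) xy] xy(3) by auto
qed

lemma asc_tableau_at_step:
  assumes \<pi>: "\<pi> \<in> matchings n" and k: "Suc k < a" "a \<le> 2 * n" and ne: "\<pi> (Suc k) \<noteq> a" "\<pi> (Suc k) \<noteq> Suc a"
  shows "asc (tableau_at \<pi> k) a \<Longrightarrow> asc (tableau_at \<pi> (Suc k)) a"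
    and "desc (tableau_at \<pi> k) a \<Longrightarrow> desc (tableau_at \<pi> (Suc k)) a"
proof -
  let ?P = "tableau_at \<pi> k"
  have P: "standard ?P" and k': "k < 2 * n" using tableau_at_entries[OF \<pi>, of k] k by auto
  have "(asc ?P a \<longrightarrow> asc (tableau_at \<pi> (Suc k)) a) \<and> (desc ?P a \<longrightarrow> desc (tableau_at \<pi> (Suc k)) a)"
  proof (cases "Suc k < \<pi> (Suc k)")
    case True
    show ?thesis
      using tableau_at_open[OF \<pi> k' True] asc_row_insert[OF P] desc_row_insert[OF P] ne by auto
  next
    case False
    obtain V e g where sl: "slides (shape ?P) (ent ?P) (0, 0) V e g" "(0, 0) \<in> shape ?P"
      "shape (tableau_at \<pi> (Suc k)) = shape ?P - {e}"
      "\<And>b. b \<in> shape ?P - {e} \<Longrightarrow> ent (tableau_at \<pi> (Suc k)) b = g b"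
      using tableau_at_close[OF \<pi> k' False] by metis
    have "young_diagram (shape ?P)" "std (shape ?P - {(0, 0)}) (ent ?P)"
      using P by (auto simp: standard_def std_def inj_on_def)
    note slides_ascent[OF sl(1) this(1) sl(2) this(2), of a]
    moreover have "asc (tableau_at \<pi> (Suc k)) a \<longleftrightarrow> ascent (shape ?P - {e}) g a"
      "desc (tableau_at \<pi> (Suc k)) a \<longleftrightarrow> descent (shape ?P - {e}) g a"
      unfolding ascent_def descent_def sl(3) using sl(4) by auto
    moreover have "asc ?P a \<Longrightarrow> ascent (shape ?P - {(0, 0)}) (ent ?P) a"
      "desc ?P a \<Longrightarrow> descent (shape ?P - {(0, 0)}) (ent ?P) a"
      by (auto simp: ascent_def descent_def)
    ultimately show ?thesis by blast
  qed
  then show "asc ?P a \<Longrightarrow> asc (tableau_at \<pi> (Suc k)) a" "desc ?P a \<Longrightarrow> desc (tableau_at \<pi> (Suc k)) a"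
    by auto
qed

text \<open>The later of the two insertions decides. If it is that of \<open>Suc a\<close>, then
  \<open>Suc a\<close> is in the top row at that moment; if it is that of \<open>a\<close>, then
  \<open>a\<close> is there and \<open>Suc a\<close> is not. The steps up to \<open>k\<close> insert
  neither and preserve this.\<close>

lemma asc_tableau_at:
  assumes \<pi>: "\<pi> \<in> matchings n" and a: "Suc k = a" "Suc a \<le> 2 * n"
    and cl: "\<pi> a < a" "\<pi> (Suc a) < Suc a"
  shows "\<pi> a < \<pi> (Suc a) \<Longrightarrow> asc (tableau_at \<pi> k) a"
    and "\<pi> (Suc a) < \<pi> a \<Longrightarrow> desc (tableau_at \<pi> k) a"
proof -
  have a1: "1 \<le> a" "a \<le> 2 * n" using a by auto
  note pa = matchingD[OF \<pi> a1] and pb = matchingD[OF \<pi> _ a(2)]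
  have pbn: "\<pi> (Suc a) \<noteq> a"
  proof
    assume "\<pi> (Suc a) = a"
    then have "\<pi> a = Suc a" using pb(3) by simp
    then show False using cl by simp
  qed
  have persist: "(asc (tableau_at \<pi> m) a \<longrightarrow> asc (tableau_at \<pi> k) a) \<and>
      (desc (tableau_at \<pi> m) a \<longrightarrow> desc (tableau_at \<pi> k) a)"
    if "\<pi> a \<le> m" "\<pi> (Suc a) \<le> m" "m \<le> k" for m
    using that(3,1,2)
  proof (induction m rule: inc_induct)
    case (step m)
    have "\<pi> (Suc m) \<noteq> a" "\<pi> (Suc m) \<noteq> Suc a"
      using matchingD(3)[OF \<pi>, of "Suc m"] step.prems step.hyps a by auto
    then show ?case using asc_tableau_at_step[OF \<pi> _ a1(2), of m] step a by auto
  qed simp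
  have ins: "tableau_at \<pi> (\<pi> j) = row_insert j (tableau_at \<pi> (\<pi> j - 1)) \<and>
      standard (tableau_at \<pi> (\<pi> j - 1)) \<and> j \<notin> entries (tableau_at \<pi> (\<pi> j - 1))"
    if "\<pi> j < j" "1 \<le> j" "j \<le> 2 * n" for j
  proof -
    note pj = matchingD[OF \<pi> that(2,3)]
    have "Suc (\<pi> j - 1) = \<pi> j" using pj by simp
    then show ?thesis
      using tableau_at_open[OF \<pi>, of "\<pi> j - 1"] tableau_at_entries[OF \<pi>, of "\<pi> j - 1"] pj that by auto
  qed
  show "asc (tableau_at \<pi> k) a" if "\<pi> a < \<pi> (Suc a)"
  proof -
    have "asc (tableau_at \<pi> (\<pi> (Suc a))) a"
      using ins[OF cl(2)] a asc_row_insert_Suc by auto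
    then show ?thesis using persist[of "\<pi> (Suc a)"] that cl pbn a by auto
  qed
  show "desc (tableau_at \<pi> k) a" if "\<pi> (Suc a) < \<pi> a"
  proof -
    have "desc (tableau_at \<pi> (\<pi> a)) a"
      using ins[OF cl(1)] a1 desc_row_insert_self by auto
    then show ?thesis using persist[of "\<pi> a"] that cl a by auto
  qed
qed

lemma descent_close:
  assumes \<pi>: "\<pi> \<in> matchings n" and k: "Suc k < 2 * n"
    and cl: "\<not> Suc k < \<pi> (Suc k)" "\<not> Suc (Suc k) < \<pi> (Suc (Suc k))"
    and b: "b \<notin> shape (tableau_at \<pi> (Suc k))" "shape (tableau_at \<pi> k) = insert b (shape (tableau_at \<pi> (Suc k)))"
    and b': "b' \<notin> shape (tableau_at \<pi> (Suc (Suc k)))"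
      "shape (tableau_at \<pi> (Suc k)) = insert b' (shape (tableau_at \<pi> (Suc (Suc k))))"
  shows "\<pi> (Suc k) > \<pi> (Suc (Suc k)) \<longleftrightarrow> fst b' < fst b"
proof -
  let ?P = "tableau_at \<pi> k" let ?Q = "tableau_at \<pi> (Suc k)" let ?R = "tableau_at \<pi> (Suc (Suc k))"
  let ?D = "shape ?P" let ?a = "Suc k"
  have le: "k \<le> 2 * n" "Suc k \<le> 2 * n" "Suc (Suc k) \<le> 2 * n" using k by auto
  have lt: "\<pi> ?a < ?a" "\<pi> (Suc ?a) < Suc ?a"
    using matchingD(4)[OF \<pi>, of ?a] matchingD(4)[OF \<pi>, of "Suc ?a"] cl k by auto
  note T = tableau_at_entries[OF \<pi> le(1)] tableau_at_entries[OF \<pi> le(2)] tableau_at_entries[OF \<pi> le(3)]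
  have y: "young_diagram ?D" "young_diagram (shape ?Q)" "young_diagram (shape ?R)" and s: "std ?D (ent ?P)"
    using T by (auto simp: standard_def)
  obtain V e g where 1: "slides ?D (ent ?P) (0, 0) V e g" "(0, 0) \<in> ?D" "ent ?P (0, 0) = ?a"
    "e \<in> ?D" "shape ?Q = ?D - {e}" "\<And>p. p \<in> ?D - {e} \<Longrightarrow> ent ?Q p = g p"
    using tableau_at_close[OF \<pi> _ cl(1)] k by (metis Suc_lessD)
  obtain W e' g' where 2: "slides (shape ?Q) (ent ?Q) (0, 0) W e' g'"
    "e' \<in> shape ?Q" "shape ?R = shape ?Q - {e'}"
    using tableau_at_close[OF \<pi> k cl(2)] by metis
  have e: "e = b" "e' = b'" using 1(4,5) 2(2,3) b b' by auto
  have s0: "std (?D - {(0, 0)}) (ent ?P)" using s by (auto simp: std_def inj_on_def)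
  have "\<pi> (Suc ?a) \<noteq> ?a"
  proof
    assume "\<pi> (Suc ?a) = ?a"
    then have "\<pi> ?a = Suc ?a" using matchingD(3)[OF \<pi>, of "Suc ?a"] le by simp
    then show False using lt by simp
  qed
  then have "Suc ?a \<in> entries ?P" using T(1) lt k by simp
  then obtain r c where rc: "(r, c) \<in> ?D" "ent ?P (r, c) = Suc ?a" by (rule in_entriesE)
  \<comment> \<open>Another box up to \<open>(r, c)\<close>, apart from the corner, would hold an
    entry strictly between \<open>?a\<close> and \<open>Suc ?a\<close>. This leaves
    \<open>(0, 1)\<close> or \<open>(1, 0)\<close> for \<open>Suc ?a\<close>, and the first hole
    moves there at once.\<close>
  have next_box: "q = (r, c)" if "q \<in> ?D" "q \<noteq> (0, 0)" "fst q \<le> r" "snd q \<le> c" for q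
  proof (rule ccontr)
    assume "q \<noteq> (r, c)"
    then have "ent ?P q < Suc ?a" using std_mono[OF s that(1) rc(1)] rc(2) that by auto
    moreover have "?a < ent ?P q" using std_mono[OF s 1(2) that(1)] that 1(3) by simp
    ultimately show False by simp
  qed
  have ne0: "(r, c) \<noteq> (0, 0)" using rc(2) 1(3) by (metis n_not_Suc_n)
  have small: "ent ?P (r, c) < ent ?P p" if "p \<in> ?D" "p \<noteq> (r, c)" "p \<noteq> (0, 0)" for p
  proof -
    have "?a < ent ?P p" using std_mono[OF s 1(2) that(1)] that 1(3) by simp
    moreover have "ent ?P p \<noteq> Suc ?a" using std_inj[OF s that(1) rc(1)] that(2) rc(2) by auto
    ultimately show ?thesis using rc(2) by simp
  qed
  have inD: "q \<in> ?D" if "fst q \<le> r" "snd q \<le> c" for q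
    using young_diagram_mono[OF y(1) rc(1)] that by simp
  have first: "(r, c) \<in> V" if "(r, c) \<in> nbrs (0, 0)"
    using slides_first[OF 1(1) that rc(1)] small by fastforce
  show ?thesis
  proof (cases "\<pi> ?a < \<pi> (Suc ?a)")
    case True
    then have "asc ?P ?a" using asc_tableau_at(1)[OF \<pi> refl le(3) lt] by simp
    then have "r = 0" unfolding ascent_def using 1(2,3) rc by fastforce
    then have "(r, c) = (0, 1)" using next_box[of "(0, 1)"] inD[of "(0, 1)"] ne0 by auto
    then have "(0, 1) \<in> V" using first by (auto simp: nbrs_def)
    then have "fst e \<le> fst e'"
      using slides_noncrossing[OF y(1) 1(2) s0 1(1) _ 2(1)[unfolded 1(5)] 1(6)] by blast
    then show ?thesis using e True by simp
  next
    case False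
    moreover have "\<pi> ?a \<noteq> \<pi> (Suc ?a)"
      using matchingD(3)[OF \<pi>, of ?a] matchingD(3)[OF \<pi>, of "Suc ?a"] le by auto
    ultimately have gt: "\<pi> (Suc ?a) < \<pi> ?a" by simp
    then have "desc ?P ?a" using asc_tableau_at(2)[OF \<pi> refl le(3) lt] by simp
    then have "0 < r" unfolding descent_def using 1(2,3) rc by fastforce
    then have "(r, c) = (1, 0)" using next_box[of "(1, 0)"] inD[of "(1, 0)"] by auto
    then have V: "(1, 0) \<in> V" using first by (auto simp: nbrs_def)
    \<comment> \<open>The mirror image of the other case compares the columns of the two ends;
      \<open>successive_boxes\<close> turns this into rows.\<close>
    have "fst (prod.swap e) \<le> fst (prod.swap e')"
    proof (rule slides_noncrossing)
      show "young_diagram (conjugate ?D)" using y(1) by simp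
      show "(0, 0) \<in> conjugate ?D" "(0, 1) \<in> conjugate V" using 1(2) V by (auto simp: in_conjugate)
      have "conjugate (?D - {(0, 0)}) = conjugate ?D - {(0, 0)}" by (auto simp: in_conjugate)
      then show "std (conjugate ?D - {(0, 0)}) (ent ?P \<circ> prod.swap)"
        using std_conjugate[OF s0] by simp
      show "slides (conjugate ?D) (ent ?P \<circ> prod.swap) (0, 0) (conjugate V) (prod.swap e) (g \<circ> prod.swap)"
        using slides_conjugate[OF 1(1)] by simp
      have D': "conjugate ?D - {prod.swap e} = conjugate (shape ?Q)"
        unfolding 1(5) by (auto simp: in_conjugate)
      show "slides (conjugate ?D - {prod.swap e}) (ent ?Q \<circ> prod.swap) (0, 0) (conjugate W) (prod.swap e') (g' \<circ> prod.swap)"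
        unfolding D' using slides_conjugate[OF 2(1)] by simp
      show "(ent ?Q \<circ> prod.swap) p = (g \<circ> prod.swap) p" if "p \<in> conjugate ?D - {prod.swap e}" for p
        using that 1(6)[of "prod.swap p"] unfolding D' 1(5) by (simp add: in_conjugate)
    qed
    then have "\<not> snd b' < snd b" using e by simp
    then show ?thesis
      using successive_boxes[of "shape ?R" b' b] y b b' gt by simp
  qed
qed

section \<open>Surjectivity and counting\<close>

lemma involution_in_matchings:
  assumes "\<And>j. j \<notin> {1..2 * n} \<Longrightarrow> \<pi> j = j"
    and "\<And>j. j \<in> {1..2 * n} \<Longrightarrow> \<pi> j \<in> {1..2 * n} \<and> \<pi> j \<noteq> j \<and> \<pi> (\<pi> j) = j"
  shows "\<pi> \<in> matchings n"
proof -
  have inv: "\<pi> (\<pi> j) = j" for j using assms by (cases "j \<in> {1..2 * n}") auto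
  then have "\<pi> permutes {1..2 * n}" unfolding permutes_def using assms(1) by metis
  then show ?thesis using assms(2) inv by (auto simp: matchings_def fun_eq_iff)
qed

lemma tableau_at_shape_step:
  assumes \<pi>: "\<pi> \<in> matchings n" and k: "k < 2 * n"
  shows "Suc k < \<pi> (Suc k) \<Longrightarrow>
      \<exists>b. b \<notin> shape (tableau_at \<pi> k) \<and> shape (tableau_at \<pi> (Suc k)) = insert b (shape (tableau_at \<pi> k))"
    and "\<not> Suc k < \<pi> (Suc k) \<Longrightarrow>
      \<exists>b. b \<notin> shape (tableau_at \<pi> (Suc k)) \<and> shape (tableau_at \<pi> k) = insert b (shape (tableau_at \<pi> (Suc k)))"
proof -
  show "\<exists>b. b \<notin> shape (tableau_at \<pi> k) \<and> shape (tableau_at \<pi> (Suc k)) = insert b (shape (tableau_at \<pi> k))"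
    if "Suc k < \<pi> (Suc k)"
    using tableau_at_open(1)[OF \<pi> k that] ins_box_notin shape_row_insert by metis
  show "\<exists>b. b \<notin> shape (tableau_at \<pi> (Suc k)) \<and> shape (tableau_at \<pi> k) = insert b (shape (tableau_at \<pi> (Suc k)))"
    if cl: "\<not> Suc k < \<pi> (Suc k)"
  proof -
    obtain e where "e \<in> shape (tableau_at \<pi> k)" "shape (tableau_at \<pi> (Suc k)) = shape (tableau_at \<pi> k) - {e}"
      using tableau_at_close[OF \<pi> k cl] by metis
    then show ?thesis by (intro exI[of _ e]) auto
  qed
qed

lemma young_diagram_tableau_at:
  "\<pi> \<in> matchings n \<Longrightarrow> k \<le> 2 * n \<Longrightarrow> young_diagram (shape (tableau_at \<pi> k))"
  using tableau_at_entries[of \<pi> n k] by (simp add: standard_def)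

lemma oscillating_of_nth: "k \<le> 2 * n \<Longrightarrow> oscillating_of n \<pi> ! k = shape (tableau_at \<pi> k)"
  by (simp add: oscillating_of_def del: upt_Suc)

lemma conjugate_oscillating_in:
  assumes \<pi>: "\<pi> \<in> matchings n"
  shows "conjugate_oscillating (oscillating_of n \<pi>) \<in> oscillating_tableaux (2 * n) {}"
proof -
  let ?S = "\<lambda>k. shape (tableau_at \<pi> k)"
  let ?C = "conjugate_oscillating (oscillating_of n \<pi>)"
  have len: "length ?C = 2 * n + 1" by (simp add: conjugate_oscillating_def oscillating_of_def)
  have nth: "?C ! k = conjugate (?S k)" if "k \<le> 2 * n" for k
    using that oscillating_of_nth[OF that, of \<pi>] by (simp add: conjugate_oscillating_def oscillating_of_def del: upt_Suc)
  have "entries (tableau_at \<pi> (2 * n)) = {}" using tableau_at_entries[OF \<pi>, of "2 * n"] by auto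
  then have "?S (2 * n) = {}" by (simp add: entries_def)
  moreover have "young_diagram E" if "E \<in> set ?C" for E
  proof -
    obtain k where "k < length ?C" "E = ?C ! k" using \<open>E \<in> set ?C\<close> by (metis in_set_conv_nth)
    then have "k \<le> 2 * n" "E = ?C ! k" using len by auto
    then show ?thesis using nth young_diagram_tableau_at[OF \<pi>] by simp
  qed
  moreover have "\<exists>b. b \<notin> ?C ! k \<and> ?C ! (k + 1) = insert b (?C ! k) \<or>
      b \<notin> ?C ! (k + 1) \<and> ?C ! k = insert b (?C ! (k + 1))" if k: "k < 2 * n" for k
  proof -
    obtain b where "b \<notin> ?S k \<and> ?S (Suc k) = insert b (?S k) \<or> b \<notin> ?S (Suc k) \<and> ?S k = insert b (?S (Suc k))"
      using tableau_at_shape_step[OF \<pi> k] by blast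
    then show ?thesis using nth[of k] nth[of "Suc k"] k
      by (intro exI[of _ "prod.swap b"]) (auto simp: conjugate_insert simp del: tableau_at.simps)
  qed
  ultimately show ?thesis using len nth[of 0] nth[of "2 * n"]
    by (simp add: oscillating_tableaux_def conjugate_def)
qed

text \<open>Read backwards, the shapes determine the tableaux: a box that was added is removed by a reverse
  row insertion, a box that was removed is brought back by a reverse slide. The involution \<open>\<sigma>\<close> collects
  the blocks contained in \<open>{k + 1..2 * n}\<close>.\<close>

lemma oscillating_of_surj:
  assumes Ds: "Ds \<in> oscillating_tableaux (2 * n) {}"
  shows "\<exists>\<pi>\<in>matchings n. oscillating_of n \<pi> = Ds"
proof -
  have len: "length Ds = 2 * n + 1" and D0: "Ds ! 0 = {}" and Dn: "Ds ! (2 * n) = {}"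
    and step: "\<And>k. k < 2 * n \<Longrightarrow> \<exists>b. b \<notin> Ds ! k \<and> Ds ! Suc k = insert b (Ds ! k) \<or>
      b \<notin> Ds ! Suc k \<and> Ds ! k = insert b (Ds ! Suc k)"
    using Ds by (auto simp: oscillating_tableaux_def)
  have y: "young_diagram (Ds ! k)" if "k \<le> 2 * n" for k
    using Ds nth_mem[of k Ds] that by (auto simp: oscillating_tableaux_def)
  \<comment> \<open>Entries of \<open>Q\<close> belong to blocks whose smaller end is at most
    \<open>k\<close> and still unknown. Hence \<open>\<sigma>\<close> acts only on the other
    numbers, and the last clause speaks of every \<open>\<pi>\<close> that completes
    \<open>\<sigma>\<close> and reaches \<open>Q\<close> at time \<open>k\<close>.\<close>
  define good where "good k Q \<sigma> \<longleftrightarrow>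
      standard Q \<and> shape Q = Ds ! k \<and> entries Q \<subseteq> {k<..2 * n} \<and>
      (\<forall>j. j \<notin> {k<..2 * n} - entries Q \<longrightarrow> \<sigma> j = j) \<and>
      (\<forall>j\<in>{k<..2 * n} - entries Q. \<sigma> j \<in> {k<..2 * n} - entries Q \<and> \<sigma> j \<noteq> j \<and> \<sigma> (\<sigma> j) = j) \<and>
      (\<forall>\<pi>. (\<forall>j\<in>{k<..2 * n} - entries Q. \<pi> j = \<sigma> j) \<and> (\<forall>j\<in>entries Q. \<pi> j \<le> k) \<and> tableau_at \<pi> k = Q \<longrightarrow>
        (\<forall>l\<in>{k..2 * n}. shape (tableau_at \<pi> l) = Ds ! l))" for k Q \<sigma>
  have "\<exists>Q \<sigma>. good k Q \<sigma>" if "k \<le> 2 * n" for k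
    using that
  proof (induction k rule: inc_induct)
    case base
    show ?case by (intro exI[of _ "[]"] exI[of _ id]) (auto simp: good_def Dn)
  next
    case (step k)
    then obtain Q \<sigma> where "good (Suc k) Q \<sigma>" by blast
    then have Q: "standard Q" "shape Q = Ds ! Suc k" "entries Q \<subseteq> {Suc k<..2 * n}"
      and \<sigma>: "\<And>j. j \<notin> {Suc k<..2 * n} - entries Q \<Longrightarrow> \<sigma> j = j"
        "\<And>j. j \<in> {Suc k<..2 * n} - entries Q \<Longrightarrow> \<sigma> j \<in> {Suc k<..2 * n} - entries Q \<and> \<sigma> j \<noteq> j \<and> \<sigma> (\<sigma> j) = j"
      and ext: "\<And>\<pi>. (\<And>j. j \<in> {Suc k<..2 * n} - entries Q \<Longrightarrow> \<pi> j = \<sigma> j) \<Longrightarrow>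
        (\<And>j. j \<in> entries Q \<Longrightarrow> \<pi> j \<le> Suc k) \<Longrightarrow> tableau_at \<pi> (Suc k) = Q \<Longrightarrow>
        (\<forall>l\<in>{Suc k..2 * n}. shape (tableau_at \<pi> l) = Ds ! l)"
      unfolding good_def by blast+
    have up: "{k..2 * n} = insert k {Suc k..2 * n}" "{k<..2 * n} = insert (Suc k) {Suc k<..2 * n}"
      using step.hyps by auto
    have k: "Suc k \<notin> entries Q" using Q(3) by auto
    obtain b where "b \<notin> Ds ! k \<and> Ds ! Suc k = insert b (Ds ! k) \<or> b \<notin> Ds ! Suc k \<and> Ds ! k = insert b (Ds ! Suc k)"
      using \<open>\<And>k. k < 2 * n \<Longrightarrow> _ k\<close> step.hyps by blast
    then show ?case
    proof (elim disjE conjE)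
      assume b: "b \<notin> Ds ! k" "Ds ! Suc k = insert b (Ds ! k)"
      have "shape Q - {b} = Ds ! k" using Q(2) b by auto
      then obtain x P where P: "standard P" "x \<notin> entries P" "row_insert x P = Q" "shape P = Ds ! k"
        using row_insert_surj[OF Q(1), of b] Q(2) b y[of k] step.hyps by auto
      have eQ: "entries Q = insert x (entries P)" using standard_row_insert P by blast
      have x: "Suc k < x" "x \<le> 2 * n" using eQ Q(3) by auto
      \<comment> \<open>The expelled entry \<open>x\<close> is the partner of the opener
        \<open>Suc k\<close>.\<close>
      let ?\<sigma> = "\<sigma>(Suc k := x, x := Suc k)"
      have dom: "{k<..2 * n} - entries P = insert x (insert (Suc k) ({Suc k<..2 * n} - entries Q))"
        using up(2) x k eQ P(2) by auto
      have nin: "x \<notin> {Suc k<..2 * n} - entries Q" "Suc k \<notin> {Suc k<..2 * n} - entries Q"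
        using eQ by auto
      have upd: "?\<sigma> j = \<sigma> j" if "j \<in> {Suc k<..2 * n} - entries Q" for j using that nin by auto
      have "good k P ?\<sigma>" unfolding good_def dom
      proof (intro conjI allI impI ballI)
        show "entries P \<subseteq> {k<..2 * n}" using Q(3) eQ by auto
        show "?\<sigma> j = j" if "j \<notin> insert x (insert (Suc k) ({Suc k<..2 * n} - entries Q))" for j
          using that \<sigma>(1) by auto
        fix j assume j: "j \<in> insert x (insert (Suc k) ({Suc k<..2 * n} - entries Q))"
        then consider "j = x" | "j = Suc k" | "j \<in> {Suc k<..2 * n} - entries Q" by blast
        then have "?\<sigma> j \<in> insert x (insert (Suc k) ({Suc k<..2 * n} - entries Q)) \<and> ?\<sigma> j \<noteq> j \<and> ?\<sigma> (?\<sigma> j) = j"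
        proof cases
          case 3
          then show ?thesis using upd[OF 3] \<sigma>(2)[OF 3] upd[of "\<sigma> j"] by auto
        qed (use x in auto)
        then show "?\<sigma> j \<in> insert x (insert (Suc k) ({Suc k<..2 * n} - entries Q))" "?\<sigma> j \<noteq> j" "?\<sigma> (?\<sigma> j) = j"
          by blast+
      next
        fix \<pi> l
        assume l: "l \<in> {k..2 * n}"
          and "(\<forall>j\<in>insert x (insert (Suc k) ({Suc k<..2 * n} - entries Q)). \<pi> j = ?\<sigma> j) \<and>
            (\<forall>j\<in>entries P. \<pi> j \<le> k) \<and> tableau_at \<pi> k = P"
        then have \<pi>: "\<And>j. j \<in> insert x (insert (Suc k) ({Suc k<..2 * n} - entries Q)) \<Longrightarrow> \<pi> j = ?\<sigma> j"
            "\<And>j. j \<in> entries P \<Longrightarrow> \<pi> j \<le> k" "tableau_at \<pi> k = P" by blast+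
        have pk: "\<pi> (Suc k) = x" "\<pi> x = Suc k" using \<pi>(1)[of "Suc k"] \<pi>(1)[of x] x by auto
        have "tableau_at \<pi> (Suc k) = Q" using \<pi>(3) pk x P(3) by simp
        moreover have "\<pi> j = \<sigma> j" if "j \<in> {Suc k<..2 * n} - entries Q" for j
          by (rule trans[OF _ upd[OF that]]) (use \<pi>(1) that in blast)
        moreover have "\<pi> j \<le> Suc k" if "j \<in> entries Q" for j
          using that eQ pk \<pi>(2)[of j] by (cases "j = x") auto
        ultimately have "\<forall>l\<in>{Suc k..2 * n}. shape (tableau_at \<pi> l) = Ds ! l" using ext by blast
        then show "shape (tableau_at \<pi> l) = Ds ! l" using l up(1) \<pi>(3) P(4) by auto
      qed (use P in auto)
      then show ?thesis by blast
    next
      assume b: "b \<notin> Ds ! Suc k" "Ds ! k = insert b (Ds ! Suc k)"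
      have "Suc k < x" if "x \<in> entries Q" for x using Q(3) that by auto
      then obtain P where P: "standard P" "shape P = insert b (shape Q)" "entries P = insert (Suc k) (entries Q)"
          "remove_entry (Suc k) P = Q"
        using remove_entry_surj[OF Q(1), of "Suc k" b] Q(2) b y[of k] step.hyps by auto
      have dom: "{k<..2 * n} - entries P = {Suc k<..2 * n} - entries Q"
        using up(2) P(3) by auto
      have "good k P \<sigma>" unfolding good_def dom
      proof (intro conjI allI impI ballI)
        show "entries P \<subseteq> {k<..2 * n}" using Q(3) P(3) step.hyps by auto
        fix \<pi> l
        assume l: "l \<in> {k..2 * n}"
          and "(\<forall>j\<in>{Suc k<..2 * n} - entries Q. \<pi> j = \<sigma> j) \<and>
            (\<forall>j\<in>entries P. \<pi> j \<le> k) \<and> tableau_at \<pi> k = P"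
        then have \<pi>: "\<And>j. j \<in> {Suc k<..2 * n} - entries Q \<Longrightarrow> \<pi> j = \<sigma> j"
            "\<And>j. j \<in> entries P \<Longrightarrow> \<pi> j \<le> k" "tableau_at \<pi> k = P" by blast+
        \<comment> \<open>As an entry of \<open>P\<close>, \<open>Suc k\<close> has an earlier
          partner, so step \<open>Suc k\<close> removes it.\<close>
        have "\<pi> (Suc k) \<le> k" using \<pi>(2) P(3) by blast
        then have "tableau_at \<pi> (Suc k) = Q" using \<pi>(3) P(4) by simp
        moreover have "\<pi> j \<le> Suc k" if "j \<in> entries Q" for j
          using that P(3) \<pi>(2)[of j] by auto
        ultimately have "\<forall>l\<in>{Suc k..2 * n}. shape (tableau_at \<pi> l) = Ds ! l" using ext \<pi>(1) by blast
        then show "shape (tableau_at \<pi> l) = Ds ! l" using l up(1) \<pi>(3) P(2) Q(2) b by auto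
      qed (use P Q b \<sigma> in auto)
      then show ?thesis by blast
    qed
  qed
  then obtain Q \<sigma> where g: "good 0 Q \<sigma>" by blast
  then have "shape Q = {}" "[] \<notin> set Q" using D0 by (auto simp: good_def standard_def)
  then have Q: "Q = []" using tableau_eqI[of Q "[]"] by simp
  \<comment> \<open>At time 0 no block is open, so \<open>\<sigma>\<close> is an involution of all
    of \<open>{1..2 * n}\<close> and its own completion.\<close>
  have "{0<..2 * n} = {1..2 * n}" by auto
  with g Q have "\<sigma> \<in> matchings n" "\<forall>l\<le>2 * n. shape (tableau_at \<sigma> l) = Ds ! l"
    unfolding good_def by (auto intro!: involution_in_matchings)
  moreover from this(2) have "oscillating_of n \<sigma> = Ds"
    by (intro nth_equalityI) (auto simp: oscillating_of_nth len oscillating_of_def[THEN arg_cong[of _ _ length]])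
  ultimately show ?thesis by blast
qed

section \<open>Comparing the descents of a matching and its conjugate\<close>

text \<open>Openers are the steps at which the number of boxes grows, and transposition keeps that
  number.\<close>

lemma openers_eq:
  assumes \<pi>: "\<pi> \<in> matchings n" and \<pi>': "\<pi>' \<in> matchings n"
    and conj: "\<And>k. k \<le> 2 * n \<Longrightarrow> shape (tableau_at \<pi>' k) = conjugate (shape (tableau_at \<pi> k))"
    and k: "k < 2 * n"
  shows "Suc k < \<pi>' (Suc k) \<longleftrightarrow> Suc k < \<pi> (Suc k)"
proof -
  have "Suc k < \<pi> (Suc k) \<longleftrightarrow> card (shape (tableau_at \<pi> k)) < card (shape (tableau_at \<pi> (Suc k)))"
    if "\<pi> \<in> matchings n" for \<pi>
  proof (cases "Suc k < \<pi> (Suc k)")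
    case True
    then show ?thesis using tableau_at_shape_step(1)[OF that k True] by auto
  next
    case False
    then show ?thesis using tableau_at_shape_step(2)[OF that k False] by auto
  qed
  moreover have "card (conjugate D) = card D" for D
    unfolding conjugate_def by (simp add: card_image)
  ultimately show ?thesis using \<pi> \<pi>' conj[of k] conj[of "Suc k"] k
    by (simp del: tableau_at.simps)
qed

lemma descents_conjugate:
  assumes \<pi>: "\<pi> \<in> matchings n" and \<pi>': "\<pi>' \<in> matchings n"
    and conj: "\<And>k. k \<le> 2 * n \<Longrightarrow> shape (tableau_at \<pi>' k) = conjugate (shape (tableau_at \<pi> k))"
    and i: "1 \<le> i" "i < 2 * n"
  shows "of_bool (\<pi> i > \<pi> (Suc i)) + of_bool (\<pi>' i > \<pi>' (Suc i)) =
    1 + of_bool (i < \<pi> i) - (of_bool (Suc i < \<pi> (Suc i)) :: int)"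
proof -
  obtain k where k: "i = Suc k" using i(1) by (cases i) auto
  have k1: "k < 2 * n" "Suc k < 2 * n" "k \<le> 2 * n" "Suc k \<le> 2 * n" "Suc (Suc k) \<le> 2 * n" using i k by auto
  let ?A = "shape (tableau_at \<pi> k)" let ?B = "shape (tableau_at \<pi> (Suc k))"
  let ?C = "shape (tableau_at \<pi> (Suc (Suc k)))"
  note y = young_diagram_tableau_at[OF \<pi> k1(3)] young_diagram_tableau_at[OF \<pi> k1(4)]
    young_diagram_tableau_at[OF \<pi> k1(5)]
  have o1: "Suc k < \<pi>' (Suc k) \<longleftrightarrow> Suc k < \<pi> (Suc k)"
    and o2: "Suc (Suc k) < \<pi>' (Suc (Suc k)) \<longleftrightarrow> Suc (Suc k) < \<pi> (Suc (Suc k))"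
    using openers_eq[OF \<pi> \<pi>' conj] k1 by auto
  have ne: "\<pi> i \<noteq> i" "\<pi>' i \<noteq> i" "\<pi> (Suc i) \<noteq> Suc i" "\<pi>' (Suc i) \<noteq> Suc i"
    using matchingD(4)[OF \<pi>] matchingD(4)[OF \<pi>'] i by auto
  have swap: "prod.swap p = prod.swap q \<longleftrightarrow> p = q" for p q :: "nat \<times> nat" by (metis swap_swap)
  note c = conj[OF k1(3)] conj[OF k1(4)] conj[OF k1(5)]
  consider "i < \<pi> i" "Suc i < \<pi> (Suc i)" | "\<not> i < \<pi> i" "\<not> Suc i < \<pi> (Suc i)"
    | "i < \<pi> i" "\<not> Suc i < \<pi> (Suc i)" | "\<not> i < \<pi> i" "Suc i < \<pi> (Suc i)" by blast
  then show ?thesis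
  proof cases
    case 1
    obtain b where b: "b \<notin> ?A" "?B = insert b ?A"
      using tableau_at_shape_step(1)[OF \<pi> k1(1)] 1 k by blast
    obtain b' where b': "b' \<notin> ?B" "?C = insert b' ?B"
      using tableau_at_shape_step(1)[OF \<pi> k1(2)] 1 k by blast
    have "\<pi> i > \<pi> (Suc i) \<longleftrightarrow> fst b < fst b'"
      using descent_open[OF \<pi> k1(2) _ _ b b'] 1 k by simp
    moreover have "\<pi>' i > \<pi>' (Suc i) \<longleftrightarrow> fst (prod.swap b) < fst (prod.swap b')"
      using descent_open[OF \<pi>' k1(2), of "prod.swap b" "prod.swap b'"] 1 k b b' o1 o2 c
      by (simp add: conjugate_insert swap del: tableau_at.simps)
    moreover have "fst b < fst b' \<longleftrightarrow> \<not> snd b < snd b'"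
      using successive_boxes[of ?A b b'] y b b' by simp
    ultimately show ?thesis using 1 by simp
  next
    case 2
    obtain b where b: "b \<notin> ?B" "?A = insert b ?B"
      using tableau_at_shape_step(2)[OF \<pi> k1(1)] 2 k by blast
    obtain b' where b': "b' \<notin> ?C" "?B = insert b' ?C"
      using tableau_at_shape_step(2)[OF \<pi> k1(2)] 2 k by blast
    have "\<pi> i > \<pi> (Suc i) \<longleftrightarrow> fst b' < fst b"
      using descent_close[OF \<pi> k1(2) _ _ b b'] 2 k by simp
    moreover have "\<pi>' i > \<pi>' (Suc i) \<longleftrightarrow> fst (prod.swap b') < fst (prod.swap b)"
      using descent_close[OF \<pi>' k1(2), of "prod.swap b" "prod.swap b'"] 2 k b b' o1 o2 c
      by (simp add: conjugate_insert swap del: tableau_at.simps)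
    moreover have "fst b' < fst b \<longleftrightarrow> \<not> snd b' < snd b"
      using successive_boxes[of ?C b' b] y b b' by simp
    ultimately show ?thesis using 2 by simp
  next
    \<comment> \<open>Here \<open>\<pi> i\<close> is at least \<open>Suc i\<close> and
      \<open>\<pi> (Suc i)\<close> is at most \<open>i\<close>; the next case is the
      opposite.\<close>
    case 3
    then have "\<pi> i > \<pi> (Suc i)" "\<pi>' i > \<pi>' (Suc i)" using ne o1 o2 k by auto
    then show ?thesis using 3 by simp
  next
    case 4
    then have "\<not> \<pi> i > \<pi> (Suc i)" "\<not> \<pi>' i > \<pi>' (Suc i)" using ne o1 o2 k by auto
    then show ?thesis using 4 by simp
  qed
qed

text \<open>Reindexing by \<open>\<pi>\<close> exchanges openers and closers, so the sum equals
  \<open>2 * n\<close> minus itself.\<close>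

lemma card_openers:
  assumes \<pi>: "\<pi> \<in> matchings n"
  shows "(\<Sum>i\<in>{1..2 * n}. of_bool (i < \<pi> i)) = (int n)"
proof -
  let ?A = "{1..2 * n}"
  have p: "\<pi> permutes ?A" using \<pi> by (simp add: matchings_def)
  have "(\<Sum>i\<in>?A. of_bool (i < \<pi> i)) = (\<Sum>i\<in>?A. of_bool (\<pi> i < \<pi> (\<pi> i)) :: int)"
    using sum.permute[OF p, of "\<lambda>i. of_bool (i < \<pi> i)"] by (simp only: comp_def)
  also have "\<dots> = (\<Sum>i\<in>?A. 1 - of_bool (i < \<pi> i))"
    using matchingD[OF \<pi>] by (intro sum.cong) (auto simp: of_bool_def)
  also have "\<dots> = 2 * int n - (\<Sum>i\<in>?A. of_bool (i < \<pi> i))" by (simp add: sum_subtractf)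
  finally show ?thesis by simp
qed

lemma sum_of_bool_filter:
  assumes "finite A"
  shows "(\<Sum>x\<in>A. f x * of_bool (P x)) = (\<Sum>x\<in>{x \<in> A. P x}. f x :: int)"
proof -
  have "(\<Sum>x\<in>A. f x * of_bool (P x)) = (\<Sum>x\<in>A. if P x then f x else 0)"
    by (intro sum.cong) auto
  then show ?thesis using sum.inter_filter[OF assms, of f P] by simp
qed

text \<open>The weighted sum is summation by parts; it turns the major index into a count of
  openers.\<close>

lemma sum_telescope_weighted:
  fixes f :: "nat \<Rightarrow> int"
  shows "(\<Sum>i\<in>{1..<Suc m}. f i - f (Suc i)) = f 1 - f (Suc m)"
    and "(\<Sum>i\<in>{1..<Suc m}. int i * (f i - f (Suc i))) = (\<Sum>i\<in>{1..m}. f i) - int m * f (Suc m)"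
  by (induction m) (auto simp: algebra_simps)

theorem theorem3p4:
  fixes n :: nat and \<pi> \<pi>' :: "nat \<Rightarrow> nat"
  assumes "n \<ge> 1"
    and "\<pi> \<in> matchings n"
    and "\<pi>' = inv_into (matchings n) (oscillating_of n)
                 (conjugate_oscillating (oscillating_of n \<pi>))"
  shows "descent_number (2 * n) \<pi> + descent_number (2 * n) \<pi>' = 2 * (n + 1) \<and>
         major_index (2 * n) \<pi> + major_index (2 * n) \<pi>' = 2 * n ^ 2"
proof -
  let ?C = "conjugate_oscillating (oscillating_of n \<pi>)"
  have "?C \<in> oscillating_of n ` matchings n"
    using oscillating_of_surj[OF conjugate_oscillating_in[OF assms(2)]] by (metis image_eqI)
  then have \<pi>': "\<pi>' \<in> matchings n" "oscillating_of n \<pi>' = ?C"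
    unfolding assms(3) by (simp_all add: inv_into_into f_inv_into_f)
  have conj: "shape (tableau_at \<pi>' k) = conjugate (shape (tableau_at \<pi> k))" if "k \<le> 2 * n" for k
    using arg_cong[OF \<pi>'(2), of "\<lambda>Ds. Ds ! k"] that
    by (simp add: oscillating_of_nth conjugate_oscillating_def) (simp add: oscillating_of_def del: upt_Suc)
  \<comment> \<open>\<open>m\<close> is the last position at which a descent is possible.\<close>
  define m where "m = 2 * n - 1"
  have m: "2 * n = Suc m" using assms(1) by (simp add: m_def)
  define op where "op i = (of_bool (i < \<pi> i) :: int)" for i
  have o1: "op 1 = 1" using matchingD(1,4)[OF assms(2), of 1] assms(1) by (simp add: op_def)
  have on: "op (Suc m) = 0" using matchingD(2)[OF assms(2), of "2 * n"] assms(1) m by (simp add: op_def)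
  \<comment> \<open>Position \<open>2 * n\<close> is a closer, so all \<open>n\<close> openers are
    among \<open>{1..m}\<close>.\<close>
  have so: "(\<Sum>i\<in>{1..m}. op i) = int n"
    using card_openers[OF assms(2)] on unfolding op_def m by simp
  have d: "int (card (descents (2 * n) \<sigma>)) = (\<Sum>i\<in>{1..<Suc m}. of_bool (\<sigma> i > \<sigma> (Suc i)))"
    "int (major_index (2 * n) \<sigma>) = (\<Sum>i\<in>{1..<Suc m}. int i * of_bool (\<sigma> i > \<sigma> (Suc i)))" for \<sigma>
  proof -
    have *: "descents (2 * n) \<sigma> = {i \<in> {1..<Suc m}. \<sigma> i > \<sigma> (Suc i)}"
      by (auto simp: descents_def m)
    show "int (card (descents (2 * n) \<sigma>)) = (\<Sum>i\<in>{1..<Suc m}. of_bool (\<sigma> i > \<sigma> (Suc i)))"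
      unfolding * using sum_of_bool_filter[of "{1..<Suc m}" "\<lambda>_. 1" "\<lambda>i. \<sigma> i > \<sigma> (Suc i)"]
      by (simp del: sum_of_bool_eq)
    show "int (major_index (2 * n) \<sigma>) = (\<Sum>i\<in>{1..<Suc m}. int i * of_bool (\<sigma> i > \<sigma> (Suc i)))"
      unfolding major_index_def * of_nat_sum by (rule sum_of_bool_filter[symmetric]) simp
  qed
  have eq: "of_bool (\<pi> i > \<pi> (Suc i)) + of_bool (\<pi>' i > \<pi>' (Suc i)) = 1 + (op i - op (Suc i))"
    if "i \<in> {1..<Suc m}" for i
    using descents_conjugate[OF assms(2) \<pi>'(1) conj, of i] that m by (simp add: op_def)
  have "int (card (descents (2 * n) \<pi>)) + int (card (descents (2 * n) \<pi>')) = (\<Sum>i\<in>{1..<Suc m}. 1 + (op i - op (Suc i)))"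
    unfolding d sum.distrib[symmetric] using eq by (intro sum.cong) auto
  also have "\<dots> = int m + 1" unfolding sum.distrib sum_telescope_weighted(1) using o1 on by simp
  finally have 1: "card (descents (2 * n) \<pi>) + card (descents (2 * n) \<pi>') = 2 * n" using m by linarith
  have "int (major_index (2 * n) \<pi>) + int (major_index (2 * n) \<pi>') =
      (\<Sum>i\<in>{1..<Suc m}. int i * (1 + (op i - op (Suc i))))"
    unfolding d sum.distrib[symmetric] using eq by (intro sum.cong) (auto simp: distrib_left[symmetric])
  also have "\<dots> = (\<Sum>i\<in>{1..<Suc m}. int i) + (\<Sum>i\<in>{1..<Suc m}. int i * (op i - op (Suc i)))"
    by (simp add: distrib_left sum.distrib)
  also have "\<dots> = (\<Sum>i\<in>{1..<Suc m}. int i) + int n" unfolding sum_telescope_weighted(2) using so on by simp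
  \<comment> \<open>The triangular number of \<open>m = 2 * n - 1\<close>; adding the
    \<open>n\<close> openers gives \<open>2 * n ^ 2\<close>.\<close>
  also have "(\<Sum>i\<in>{1..<Suc m}. int i) = int n * (2 * int n - 1)"
  proof -
    have "2 * (\<Sum>i\<in>{1..<Suc m}. int i) = int m * (int m + 1)" by (induction m) (auto simp: algebra_simps)
    also have "int m = 2 * int n - 1" using m by linarith
    finally show ?thesis by (simp add: algebra_simps)
  qed
  also have "int n * (2 * int n - 1) + int n = int (2 * n ^ 2)" by (simp add: algebra_simps power2_eq_square)
  finally have 2: "major_index (2 * n) \<pi> + major_index (2 * n) \<pi>' = 2 * n ^ 2" by linarith
  show ?thesis using 1 2 by (simp add: descent_number_def)
qed

end
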